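(* Let $(\mathsf{Cofib},\mathsf{Fib},\mathsf{Weq})$ be a model structure on a weakly idempotent complete additive category $\mathcal A$, with classes $\mathcal C$, $\mathcal F$, $\mathcal W$ of cofibrant, fibrant and trivial objects respectively. Then the homotopy category $\mathsf{Ho}(\mathcal A)$ is an additive category, and $$\mathsf{Ho}(\mathcal A)\cong\frac{\mathcal C\cap\mathcal F}{\mathcal C\cap\mathcal F\cap\mathcal W}$$ as additive categories.
   Context: An additive category is weakly idempotent complete if every split epimorphism has a kernel (equivalently, every split monomorphism has a cokernel). A model structure (Quillen) on a category $\mathcal A$ is a triple $(\mathsf{Cofib},\mathsf{Fib},\mathsf{Weq})$ of classes of morphisms satisfying the two-out-of-three axiom (for $\mathsf{Weq}$), the retract axiom (all three classes are closed under retracts), the lifting axiom (cofibrations lift against trivial fibrations, trivial cofibrations lift against fibrations) and the factorization axiom (every morphism factors as a cofibration followed by a trivial fibration and as a trivial cofibration followed by a fibration), where trivial (co)fibrations are the (co)fibrations lying in $\mathsf{Weq}$; no existence of limits or colimits beyond those of $\mathcal A$ is assumed. $X$ is cofibrant if $0\to X$ is in $\mathsf{Cofib}$, fibrant if $X\to0$ is in $\mathsf{Fib}$, trivial if $0\to X$ is in $\mathsf{Weq}$ (equivalently $X\to 0$ is). The homotopy category $\mathsf{Ho}(\mathcal A)$ is the localization $\mathcal A[\mathsf{Weq}^{-1}]$. For a full additive subcategory $\mathcal Y\subseteq\mathcal X$ of an additive category, $\mathcal X/\mathcal Y$ (also written $\frac{\mathcal X}{\mathcal Y}$) is the additive quotient: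 same objects as $\mathcal X$, morphisms modulo those factoring through an object of $\mathcal Y$. Equivalence $\cong$ means equivalence of additive categories. *)

theory Defs
  imports "HOL-Algebra.Coset"
begin

section \<open>Categories\<close>

record ('o, 'm) cat =
  Obj :: "'o set"
  Hom :: "'o \<Rightarrow> 'o \<Rightarrow> 'm set"
  Ident :: "'o \<Rightarrow> 'm"
  Comp :: "'m \<Rightarrow> 'm \<Rightarrow> 'm" (infixl "\<cdot>\<index>" 70)

text \<open>\<open>g \<cdot> f\<close> is ``first \<open>f\<close>, then \<open>g\<close>''. Hom-sets are pairwise disjoint, so a
  morphism determines its source and target and a class of morphisms is just a set.\<close>

locale category =
  fixes C :: "('o, 'm) cat" (structure)
  assumes hom_obj: "f \<in> Hom C x y \<Longrightarrow> x \<in> Obj C \<and> y \<in> Obj C"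
    and hom_disjoint: "f \<in> Hom C x y \<Longrightarrow> f \<in> Hom C x' y' \<Longrightarrow> x = x' \<and> y = y'"
    and ident_hom: "x \<in> Obj C \<Longrightarrow> Ident C x \<in> Hom C x x"
    and comp_hom: "f \<in> Hom C x y \<Longrightarrow> g \<in> Hom C y z \<Longrightarrow> g \<cdot> f \<in> Hom C x z"
    and comp_ident_right: "f \<in> Hom C x y \<Longrightarrow> f \<cdot> Ident C x = f"
    and comp_ident_left: "f \<in> Hom C x y \<Longrightarrow> Ident C y \<cdot> f = f"
    and comp_assoc: "f \<in> Hom C w x \<Longrightarrow> g \<in> Hom C x y \<Longrightarrow> h \<in> Hom C y z \<Longrightarrow>
          (h \<cdot> g) \<cdot> f = h \<cdot> (g \<cdot> f)"

definition Mor :: "('o, 'm) cat \<Rightarrow> 'm set" where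
  "Mor C = (\<Union>x\<in>Obj C. \<Union>y\<in>Obj C. Hom C x y)"

definition inverse_morphisms :: "('o, 'm) cat \<Rightarrow> 'o \<Rightarrow> 'o \<Rightarrow> 'm \<Rightarrow> 'm \<Rightarrow> bool" where
  "inverse_morphisms C x y f g \<longleftrightarrow> f \<in> Hom C x y \<and> g \<in> Hom C y x \<and>
     g \<cdot>\<^bsub>C\<^esub> f = Ident C x \<and> f \<cdot>\<^bsub>C\<^esub> g = Ident C y"

definition isomorphism :: "('o, 'm) cat \<Rightarrow> 'o \<Rightarrow> 'o \<Rightarrow> 'm \<Rightarrow> bool" where
  "isomorphism C x y f \<longleftrightarrow> (\<exists>g. inverse_morphisms C x y f g)"

definition zero_object :: "('o, 'm) cat \<Rightarrow> 'o \<Rightarrow> bool" where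
  "zero_object C z \<longleftrightarrow> z \<in> Obj C \<and>
     (\<forall>x\<in>Obj C. (\<exists>!f. f \<in> Hom C z x) \<and> (\<exists>!f. f \<in> Hom C x z))"

definition full_subcat :: "('o, 'm) cat \<Rightarrow> 'o set \<Rightarrow> ('o, 'm) cat" where
  "full_subcat C X = \<lparr> Obj = X,
     Hom = (\<lambda>x y. if x \<in> X \<and> y \<in> X then Hom C x y else {}),
     Ident = Ident C, Comp = Comp C \<rparr>"

locale cat_functor = source: category C + target: category D
  for C :: "('o, 'm) cat" and D :: "('p, 'n) cat" and Fo :: "'o \<Rightarrow> 'p" and Fm :: "'m \<Rightarrow> 'n" +
  assumes obj_map: "x \<in> Obj C \<Longrightarrow> Fo x \<in> Obj D"
    and hom_map: "f \<in> Hom C x y \<Longrightarrow> Fm f \<in> Hom D (Fo x) (Fo y)"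
    and map_ident: "x \<in> Obj C \<Longrightarrow> Fm (Ident C x) = Ident D (Fo x)"
    and map_comp: "f \<in> Hom C x y \<Longrightarrow> g \<in> Hom C y z \<Longrightarrow> Fm (g \<cdot>\<^bsub>C\<^esub> f) = Fm g \<cdot>\<^bsub>D\<^esub> Fm f"

definition naturally_isomorphic ::
  "('o, 'm) cat \<Rightarrow> ('p, 'n) cat \<Rightarrow> ('o \<Rightarrow> 'p) \<Rightarrow> ('m \<Rightarrow> 'n) \<Rightarrow> ('o \<Rightarrow> 'p) \<Rightarrow> ('m \<Rightarrow> 'n) \<Rightarrow> bool" where
  "naturally_isomorphic C D Fo Fm Go Gm \<longleftrightarrow>
     (\<exists>\<eta>. (\<forall>x\<in>Obj C. isomorphism D (Fo x) (Go x) (\<eta> x)) \<and>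
          (\<forall>x y f. f \<in> Hom C x y \<longrightarrow> Gm f \<cdot>\<^bsub>D\<^esub> \<eta> x = \<eta> y \<cdot>\<^bsub>D\<^esub> Fm f))"

section \<open>Additive categories\<close>

text \<open>The abelian groups of morphisms are given as a family \<open>G\<close> of (multiplicatively written)
  commutative groups: \<open>f \<otimes>\<^bsub>G x y\<^esub> g\<close> is the sum \<open>f + g\<close> and \<open>\<one>\<^bsub>G x y\<^esub>\<close> the zero morphism.\<close>

locale preadditive_category = category C for C :: "('o, 'm) cat" (structure) +
  fixes G :: "'o \<Rightarrow> 'o \<Rightarrow> 'm monoid"
  assumes hom_comm_group: "x \<in> Obj C \<Longrightarrow> y \<in> Obj C \<Longrightarrow> comm_group (G x y)"
    and carrier_hom: "x \<in> Obj C \<Longrightarrow> y \<in> Obj C \<Longrightarrow> carrier (G x y) = Hom C x y"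
    and comp_add_right: "g \<in> Hom C y z \<Longrightarrow> x \<in> Obj C \<Longrightarrow> (\<lambda>f. g \<cdot> f) \<in> hom (G x y) (G x z)"
    and comp_add_left: "f \<in> Hom C x y \<Longrightarrow> z \<in> Obj C \<Longrightarrow> (\<lambda>g. g \<cdot> f) \<in> hom (G y z) (G x z)"

definition biproduct ::
  "('o, 'm) cat \<Rightarrow> ('o \<Rightarrow> 'o \<Rightarrow> 'm monoid) \<Rightarrow> 'o \<Rightarrow> 'o \<Rightarrow> 'o \<Rightarrow> 'm \<Rightarrow> 'm \<Rightarrow> 'm \<Rightarrow> 'm \<Rightarrow> bool" where
  "biproduct C G x y b i j p q \<longleftrightarrow>
     i \<in> Hom C x b \<and> j \<in> Hom C y b \<and> p \<in> Hom C b x \<and> q \<in> Hom C b y \<and>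
     p \<cdot>\<^bsub>C\<^esub> i = Ident C x \<and> q \<cdot>\<^bsub>C\<^esub> j = Ident C y \<and>
     q \<cdot>\<^bsub>C\<^esub> i = \<one>\<^bsub>G x y\<^esub> \<and> p \<cdot>\<^bsub>C\<^esub> j = \<one>\<^bsub>G y x\<^esub> \<and>
     (i \<cdot>\<^bsub>C\<^esub> p) \<otimes>\<^bsub>G b b\<^esub> (j \<cdot>\<^bsub>C\<^esub> q) = Ident C b"

locale additive_category = preadditive_category +
  assumes ex_zero_object: "\<exists>z. zero_object C z"
    and ex_biproduct: "x \<in> Obj C \<Longrightarrow> y \<in> Obj C \<Longrightarrow> \<exists>b i j p q. biproduct C G x y b i j p q"

definition kernel_of ::
  "('o, 'm) cat \<Rightarrow> ('o \<Rightarrow> 'o \<Rightarrow> 'm monoid) \<Rightarrow> 'o \<Rightarrow> 'o \<Rightarrow> 'm \<Rightarrow> 'o \<Rightarrow> 'm \<Rightarrow> bool" where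
  "kernel_of C G x y f k \<kappa> \<longleftrightarrow>
     f \<in> Hom C x y \<and> \<kappa> \<in> Hom C k x \<and> f \<cdot>\<^bsub>C\<^esub> \<kappa> = \<one>\<^bsub>G k y\<^esub> \<and>
     (\<forall>t. \<forall>h \<in> Hom C t x. f \<cdot>\<^bsub>C\<^esub> h = \<one>\<^bsub>G t y\<^esub> \<longrightarrow>
        (\<exists>!u. u \<in> Hom C t k \<and> \<kappa> \<cdot>\<^bsub>C\<^esub> u = h))"

definition split_epi :: "('o, 'm) cat \<Rightarrow> 'o \<Rightarrow> 'o \<Rightarrow> 'm \<Rightarrow> bool" where
  "split_epi C x y f \<longleftrightarrow> f \<in> Hom C x y \<and> (\<exists>s \<in> Hom C y x. f \<cdot>\<^bsub>C\<^esub> s = Ident C y)"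

locale weakly_idempotent_complete_category = additive_category +
  assumes split_epi_has_kernel: "split_epi C x y f \<Longrightarrow> \<exists>k \<kappa>. kernel_of C G x y f k \<kappa>"

locale additive_functor =
  cat_functor C D Fo Fm + source: additive_category C G + target: additive_category D H
  for C :: "('o, 'm) cat" and G :: "'o \<Rightarrow> 'o \<Rightarrow> 'm monoid"
    and D :: "('p, 'n) cat" and H :: "'p \<Rightarrow> 'p \<Rightarrow> 'n monoid"
    and Fo :: "'o \<Rightarrow> 'p" and Fm :: "'m \<Rightarrow> 'n" +
  assumes map_add: "x \<in> Obj C \<Longrightarrow> y \<in> Obj C \<Longrightarrow> Fm \<in> hom (G x y) (H (Fo x) (Fo y))"

definition additively_equivalent ::
  "('o, 'm) cat \<Rightarrow> ('o \<Rightarrow> 'o \<Rightarrow> 'm monoid) \<Rightarrow> ('p, 'n) cat \<Rightarrow> ('p \<Rightarrow> 'p \<Rightarrow> 'n monoid) \<Rightarrow> bool" where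
  "additively_equivalent C G D H \<longleftrightarrow>
     additive_category C G \<and> additive_category D H \<and>
     (\<exists>Fo Fm Ko Km. additive_functor C G D H Fo Fm \<and> additive_functor D H C G Ko Km \<and>
        naturally_isomorphic C C id id (Ko \<circ> Fo) (Km \<circ> Fm) \<and>
        naturally_isomorphic D D (Fo \<circ> Ko) (Fm \<circ> Km) id id)"

section \<open>Additive quotients\<close>

definition factoring_through :: "('o, 'm) cat \<Rightarrow> 'o set \<Rightarrow> 'o \<Rightarrow> 'o \<Rightarrow> 'm set" where
  "factoring_through C Y x y = {g \<cdot>\<^bsub>C\<^esub> f | f g z. z \<in> Y \<and> f \<in> Hom C x z \<and> g \<in> Hom C z y}"

text \<open>\<open>Hom x y\<close> of the quotient is the quotient group of \<open>G x y\<close> by the morphisms that factor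
  through an object of \<open>Y\<close>. These subgroups are only meaningful if \<open>Y\<close> spans an additive
  subcategory.\<close>

definition quotient_hom_group ::
  "('o, 'm) cat \<Rightarrow> ('o \<Rightarrow> 'o \<Rightarrow> 'm monoid) \<Rightarrow> 'o set \<Rightarrow> 'o \<Rightarrow> 'o \<Rightarrow> 'm set monoid" where
  "quotient_hom_group C G Y x y = G x y Mod factoring_through C Y x y"

definition additive_quotient ::
  "('o, 'm) cat \<Rightarrow> ('o \<Rightarrow> 'o \<Rightarrow> 'm monoid) \<Rightarrow> 'o set \<Rightarrow> ('o, 'm set) cat" where
  "additive_quotient C G Y = \<lparr> Obj = Obj C,
     Hom = (\<lambda>x y. if x \<in> Obj C \<and> y \<in> Obj C then carrier (quotient_hom_group C G Y x y) else {}),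
     Ident = (\<lambda>x. factoring_through C Y x x #>\<^bsub>G x x\<^esub> Ident C x),
     Comp = (\<lambda>V U. \<Union>{factoring_through C Y x z #>\<^bsub>G x z\<^esub> (v \<cdot>\<^bsub>C\<^esub> u) | u v x y z.
                       u \<in> U \<inter> Hom C x y \<and> v \<in> V \<inter> Hom C y z}) \<rparr>"

section \<open>Localization\<close>

text \<open>The localization has as morphisms the zigzags \<open>x \<rightarrow> \<cdot> \<leftarrow> \<cdots> \<rightarrow> y\<close> whose backward
  arrows lie in \<open>W\<close>, modulo the congruence generated by the identities and composites of \<open>C\<close> and
  by \<open>w w\<inverse> = 1\<close>, \<open>w\<inverse> w = 1\<close>. A zigzag is read from left to right.\<close>

datatype 'm zigzag_step = Fwd 'm | Bwd 'm

inductive zigzag :: "('o, 'm) cat \<Rightarrow> 'm set \<Rightarrow> 'o \<Rightarrow> 'o \<Rightarrow> 'm zigzag_step list \<Rightarrow> bool"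
  for C W where
  zigzag_Nil: "x \<in> Obj C \<Longrightarrow> zigzag C W x x []"
| zigzag_Fwd: "f \<in> Hom C x y \<Longrightarrow> zigzag C W y z p \<Longrightarrow> zigzag C W x z (Fwd f # p)"
| zigzag_Bwd: "w \<in> W \<Longrightarrow> w \<in> Hom C y x \<Longrightarrow> zigzag C W y z p \<Longrightarrow> zigzag C W x z (Bwd w # p)"

inductive zigzag_eq ::
  "('o, 'm) cat \<Rightarrow> 'm set \<Rightarrow> 'o \<Rightarrow> 'o \<Rightarrow> 'm zigzag_step list \<Rightarrow> 'm zigzag_step list \<Rightarrow> bool"
  for C W where
  zigzag_eq_refl: "zigzag C W x y p \<Longrightarrow> zigzag_eq C W x y p p"
| zigzag_eq_sym: "zigzag_eq C W x y p q \<Longrightarrow> zigzag_eq C W x y q p"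
| zigzag_eq_trans: "zigzag_eq C W x y p q \<Longrightarrow> zigzag_eq C W x y q r \<Longrightarrow> zigzag_eq C W x y p r"
| zigzag_eq_append: "zigzag_eq C W x y p p' \<Longrightarrow> zigzag_eq C W y z q q' \<Longrightarrow>
    zigzag_eq C W x z (p @ q) (p' @ q')"
| zigzag_eq_ident: "x \<in> Obj C \<Longrightarrow> zigzag_eq C W x x [Fwd (Ident C x)] []"
| zigzag_eq_comp: "f \<in> Hom C x y \<Longrightarrow> g \<in> Hom C y z \<Longrightarrow>
    zigzag_eq C W x z [Fwd f, Fwd g] [Fwd (g \<cdot>\<^bsub>C\<^esub> f)]"
| zigzag_eq_Fwd_Bwd: "w \<in> W \<Longrightarrow> w \<in> Hom C x y \<Longrightarrow> zigzag_eq C W x x [Fwd w, Bwd w] []"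
| zigzag_eq_Bwd_Fwd: "w \<in> W \<Longrightarrow> w \<in> Hom C x y \<Longrightarrow> zigzag_eq C W y y [Bwd w, Fwd w] []"

text \<open>Endpoints are kept in the classes so that hom-sets of the localization are disjoint.\<close>

definition zigzag_class ::
  "('o, 'm) cat \<Rightarrow> 'm set \<Rightarrow> 'o \<Rightarrow> 'o \<Rightarrow> 'm zigzag_step list \<Rightarrow> ('o \<times> 'm zigzag_step list \<times> 'o) set" where
  "zigzag_class C W x y p = {(x, q, y) | q. zigzag_eq C W x y p q}"

definition localization ::
  "('o, 'm) cat \<Rightarrow> 'm set \<Rightarrow> ('o, ('o \<times> 'm zigzag_step list \<times> 'o) set) cat" where
  "localization C W = \<lparr> Obj = Obj C,
     Hom = (\<lambda>x y. {zigzag_class C W x y p | p. zigzag C W x y p}),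
     Ident = (\<lambda>x. zigzag_class C W x x []),
     Comp = (\<lambda>V U. \<Union>{zigzag_class C W x z (p @ q) | p q x y z. (x, p, y) \<in> U \<and> (y, q, z) \<in> V}) \<rparr>"

definition localize :: "('o, 'm) cat \<Rightarrow> 'm set \<Rightarrow> 'm \<Rightarrow> ('o \<times> 'm zigzag_step list \<times> 'o) set" where
  "localize C W f = \<Union>{zigzag_class C W x y [Fwd f] | x y. f \<in> Hom C x y}"

text \<open>The localization has the universal property of inverting \<open>W\<close>.\<close>

lemma zigzag_append:
  "zigzag C W x y p \<Longrightarrow> zigzag C W y z q \<Longrightarrow> zigzag C W x z (p @ q)"
  by (induction rule: zigzag.induct) (auto intro: zigzag.intros)

lemma zigzag_eq_objects:
  assumes "category C" and "zigzag_eq C W x y p q"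
  shows "zigzag C W x y p \<and> zigzag C W x y q"
  using assms(2)
proof (induction rule: zigzag_eq.induct)
  case (zigzag_eq_append x y p p' z q q')
  then show ?case by (auto intro: zigzag_append)
qed (use assms(1) in \<open>auto intro!: zigzag.intros
      intro: category.ident_hom category.comp_hom dest: category.hom_obj\<close>)

lemma zigzag_objects:
  assumes "category C" and "zigzag C W x y p"
  shows "x \<in> Obj C \<and> y \<in> Obj C"
  using assms(2) by (induction rule: zigzag.induct) (auto dest: category.hom_obj[OF assms(1)])

lemma zigzag_class_eq:
  "zigzag_eq C W x y p q \<Longrightarrow> zigzag_class C W x y p = zigzag_class C W x y q"
  unfolding zigzag_class_def by (auto intro: zigzag_eq.zigzag_eq_sym zigzag_eq.zigzag_eq_trans)

lemma comp_zigzag_class: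
  assumes "zigzag C W x y p" and "zigzag C W y z q"
  shows "zigzag_class C W y z q \<cdot>\<^bsub>localization C W\<^esub> zigzag_class C W x y p =
    zigzag_class C W x z (p @ q)"
proof -
  have eq: "zigzag_class C W x z (p' @ q') = zigzag_class C W x z (p @ q)"
    if "zigzag_eq C W x y p p'" "zigzag_eq C W y z q q'" for p' q'
    using that by (metis zigzag_class_eq zigzag_eq_append)
  have mem: "(a, r, b) \<in> zigzag_class C W u v s \<longleftrightarrow> a = u \<and> b = v \<and> zigzag_eq C W u v s r"
    for a r b u v s
    by (auto simp: zigzag_class_def)
  have "{zigzag_class C W a c (p' @ q') | p' q' a b c. (a, p', b) \<in> zigzag_class C W x y p \<and>
      (b, q', c) \<in> zigzag_class C W y z q} = {zigzag_class C W x z (p @ q)}" (is "?L = _")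
  proof (intro subset_antisym subsetI)
    show "X \<in> {zigzag_class C W x z (p @ q)}" if "X \<in> ?L" for X
      using that eq by (auto simp: mem)
    show "X \<in> ?L" if "X \<in> {zigzag_class C W x z (p @ q)}" for X
      using that zigzag_eq_refl[OF assms(1)] zigzag_eq_refl[OF assms(2)]
      unfolding mem mem_Collect_eq by blast
  qed
  then show ?thesis
    by (simp add: localization_def)
qed

lemma category_localization:
  assumes "category C"
  shows "category (localization C W)"
proof -
  have mem: "(x, p, y) \<in> zigzag_class C W x y p" if "zigzag C W x y p" for x y p
    using that by (auto simp: zigzag_class_def intro: zigzag_eq.zigzag_eq_refl)
  have Hom: "Hom (localization C W) x y = {zigzag_class C W x y p | p. zigzag C W x y p}" for x y
    by (simp add: localization_def)
  have Ident: "Ident (localization C W) x = zigzag_class C W x x []" for x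
    by (simp add: localization_def)
  have Obj: "Obj (localization C W) = Obj C"
    by (simp add: localization_def)
  show ?thesis
  proof
    fix f x y assume "f \<in> Hom (localization C W) x y"
    then obtain p where p: "zigzag C W x y p" "f = zigzag_class C W x y p"
      by (auto simp: Hom)
    then have xy: "x \<in> Obj C" "y \<in> Obj C"
      using zigzag_objects[OF assms] by auto
    then show "x \<in> Obj (localization C W) \<and> y \<in> Obj (localization C W)"
      by (simp add: Obj)
    show "x = x' \<and> y = y'" if "f \<in> Hom (localization C W) x' y'" for x' y'
    proof -
      from that obtain q where "f = zigzag_class C W x' y' q"
        by (auto simp: Hom)
      then have "(x, p, y) \<in> zigzag_class C W x' y' q"
        using mem[OF p(1)] p(2) by simp
      then show ?thesis
        by (simp add: zigzag_class_def)
    qed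
    show "f \<cdot>\<^bsub>localization C W\<^esub> Ident (localization C W) x = f"
      using p xy comp_zigzag_class[OF zigzag_Nil p(1)] by (simp add: Ident)
    show "Ident (localization C W) y \<cdot>\<^bsub>localization C W\<^esub> f = f"
      using p xy comp_zigzag_class[OF p(1) zigzag_Nil] by (simp add: Ident)
    show "g \<cdot>\<^bsub>localization C W\<^esub> f \<in> Hom (localization C W) x z"
      if "g \<in> Hom (localization C W) y z" for g z
      using that p comp_zigzag_class zigzag_append by (fastforce simp: Hom)
  next
    fix x assume "x \<in> Obj (localization C W)"
    then show "Ident (localization C W) x \<in> Hom (localization C W) x x"
      by (auto simp: Hom Ident Obj intro!: exI[of _ "[]"] zigzag.intros)
  next
    fix f g h w x y z
    assume "f \<in> Hom (localization C W) w x" "g \<in> Hom (localization C W) x y"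
      "h \<in> Hom (localization C W) y z"
    then obtain p q r where "zigzag C W w x p" "f = zigzag_class C W w x p"
      "zigzag C W x y q" "g = zigzag_class C W x y q"
      "zigzag C W y z r" "h = zigzag_class C W y z r"
      by (auto simp: Hom)
    then show "h \<cdot>\<^bsub>localization C W\<^esub> g \<cdot>\<^bsub>localization C W\<^esub> f =
      h \<cdot>\<^bsub>localization C W\<^esub> (g \<cdot>\<^bsub>localization C W\<^esub> f)"
      by (simp add: comp_zigzag_class zigzag_append)
  qed
qed

lemma localize_eq:
  assumes "category C" and "f \<in> Hom C x y"
  shows "localize C W f = zigzag_class C W x y [Fwd f]"
proof -
  have "{zigzag_class C W x y [Fwd f] | x y. f \<in> Hom C x y} = {zigzag_class C W x y [Fwd f]}"
    using assms(2) category.hom_disjoint[OF assms] by blast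
  then show ?thesis
    by (simp add: localize_def)
qed

lemma functor_localize:
  assumes "category C"
  shows "cat_functor C (localization C W) id (localize C W)"
proof -
  interpret category C by fact
  interpret L: category "localization C W" by (rule category_localization) fact
  have zz: "zigzag C W x y [Fwd f]" if "f \<in> Hom C x y" for f x y
    using that hom_obj[OF that] by (auto intro!: zigzag.intros)
  show ?thesis
  proof
    fix f x y assume f: "f \<in> Hom C x y"
    then show "localize C W f \<in> Hom (localization C W) (id x) (id y)"
      using zz by (auto simp: localize_eq[OF assms] localization_def)
    fix g z assume g: "g \<in> Hom C y z"
    show "localize C W (g \<cdot>\<^bsub>C\<^esub> f) = localize C W g \<cdot>\<^bsub>localization C W\<^esub> localize C W f"
      using f g comp_hom[OF f g]
      by (auto simp: localize_eq[OF assms] comp_zigzag_class zz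
          intro!: zigzag_class_eq intro: zigzag_eq.intros)
  next
    fix x assume "x \<in> Obj C"
    then show "localize C W (Ident C x) = Ident (localization C W) (id x)"
      using ident_hom localize_eq[OF assms] zigzag_class_eq[OF zigzag_eq_ident]
      by (fastforce simp: localization_def)
  qed (auto simp: localization_def)
qed

lemma localize_inverts:
  assumes "category C" and "w \<in> W" and "w \<in> Hom C x y"
  shows "inverse_morphisms (localization C W) x y (localize C W w) (zigzag_class C W y x [Bwd w])"
proof -
  have "x \<in> Obj C" "y \<in> Obj C"
    using assms category.hom_obj by fast+
  then have zz: "zigzag C W x y [Fwd w]" "zigzag C W y x [Bwd w]"
    using assms by (auto intro: zigzag.intros)
  then show ?thesis
    unfolding inverse_morphisms_def
    using comp_zigzag_class[OF zz] comp_zigzag_class[OF zz(2,1)] localize_eq[OF assms(1,3)]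
      zigzag_class_eq[OF zigzag_eq_Fwd_Bwd[OF assms(2,3)]]
      zigzag_class_eq[OF zigzag_eq_Bwd_Fwd[OF assms(2,3)]]
    by (auto simp: localization_def)
qed

lemma inverse_morphisms_unique:
  assumes "category C" and "inverse_morphisms C x y f g" and "inverse_morphisms C x y f h"
  shows "g = h"
proof -
  interpret category C by fact
  from assms(2,3) have *: "f \<in> Hom C x y" "g \<in> Hom C y x" "h \<in> Hom C y x"
    "g \<cdot>\<^bsub>C\<^esub> f = Ident C x" "f \<cdot>\<^bsub>C\<^esub> h = Ident C y"
    by (auto simp: inverse_morphisms_def)
  then have "g = g \<cdot>\<^bsub>C\<^esub> (f \<cdot>\<^bsub>C\<^esub> h)"
    by (simp add: comp_ident_right)
  also have "\<dots> = (g \<cdot>\<^bsub>C\<^esub> f) \<cdot>\<^bsub>C\<^esub> h"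
    using * comp_assoc by metis
  finally show ?thesis
    using * by (simp add: comp_ident_left)
qed

primrec zigzag_value :: "('p, 'n) cat \<Rightarrow> ('m \<Rightarrow> 'n) \<Rightarrow> ('m \<Rightarrow> 'n) \<Rightarrow> 'p \<Rightarrow> 'm zigzag_step list \<Rightarrow> 'n" where
  "zigzag_value D Fm Fi y [] = Ident D y"
| "zigzag_value D Fm Fi y (s # p) =
     zigzag_value D Fm Fi y p \<cdot>\<^bsub>D\<^esub> (case s of Fwd f \<Rightarrow> Fm f | Bwd f \<Rightarrow> Fi f)"

theorem localization_lift:
  fixes C :: "('o, 'm) cat" and D :: "('p, 'n) cat"
  assumes "cat_functor C D Fo Fm"
    and inv: "\<And>w x y. w \<in> W \<Longrightarrow> w \<in> Hom C x y \<Longrightarrow> isomorphism D (Fo x) (Fo y) (Fm w)"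
  shows "\<exists>Fm'. cat_functor (localization C W) D Fo Fm' \<and>
    (\<forall>f \<in> Mor C. Fm' (localize C W f) = Fm f)"
proof -
  interpret cat_functor C D Fo Fm by fact
  interpret L: category "localization C W"
    by (rule category_localization) (rule source.category_axioms)
  have "\<forall>w\<in>W \<inter> Mor C. \<exists>g. \<forall>x y. w \<in> Hom C x y \<longrightarrow> inverse_morphisms D (Fo x) (Fo y) (Fm w) g"
    using inv source.hom_disjoint unfolding isomorphism_def Mor_def by (metis IntD1 IntD2 UN_E)
  then obtain Fi where "\<forall>w\<in>W \<inter> Mor C. \<forall>x y. w \<in> Hom C x y \<longrightarrow>
      inverse_morphisms D (Fo x) (Fo y) (Fm w) (Fi w)"
    by metis
  then have Fi: "inverse_morphisms D (Fo x) (Fo y) (Fm w) (Fi w)"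
    if "w \<in> W" "w \<in> Hom C x y" for w x y
    using that source.hom_obj unfolding Mor_def by fastforce
  let ?v = "\<lambda>y. zigzag_value D Fm Fi (Fo y)"
  have v_hom: "?v y p \<in> Hom D (Fo x) (Fo y)" if "zigzag C W x y p" for x y p
    using that
    by induction (use Fi in \<open>auto simp: inverse_morphisms_def
        intro: target.ident_hom target.comp_hom obj_map hom_map\<close>)
  have v_append: "?v z (p @ q) = ?v z q \<cdot>\<^bsub>D\<^esub> ?v y p"
    if "zigzag C W x y p" "zigzag C W y z q" for x y z p q
    using that
  proof induction
    case (zigzag_Nil x)
    then show ?case
      using v_hom[of x z q] target.comp_ident_right by simp
  next
    case (zigzag_Fwd f x a y p)
    then show ?case
      using target.comp_assoc[OF hom_map[of f x a] v_hom[of a y p] v_hom[of y z q]] by simp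
  next
    case (zigzag_Bwd w a x y p)
    then have "Fi w \<in> Hom D (Fo x) (Fo a)"
      using Fi by (simp add: inverse_morphisms_def)
    then show ?case
      using zigzag_Bwd target.comp_assoc[OF _ v_hom[of a y p] v_hom[of y z q]] by simp
  qed
  have v_eq: "?v y p = ?v y q" if "zigzag_eq C W x y p q" for x y p q
    using that
  proof induction
    case (zigzag_eq_append x y p p' z q q')
    then show ?case
      using v_append zigzag_eq_objects[OF source.category_axioms] by metis
  next
    case (zigzag_eq_ident x)
    then show ?case
      using map_ident target.comp_ident_right[OF target.ident_hom] obj_map by simp
  next
    case (zigzag_eq_comp f x y g z)
    then show ?case
      using target.comp_ident_left[OF hom_map] map_comp
        target.comp_ident_left[OF target.comp_hom[OF hom_map hom_map]] by simp
  next
    case (zigzag_eq_Fwd_Bwd w x y)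
    then show ?case
      using Fi[of w x y] target.comp_ident_left[of "Fi w"] target.comp_ident_left[of "Fm w"]
      by (auto simp: inverse_morphisms_def)
  next
    case (zigzag_eq_Bwd_Fwd w x y)
    then show ?case
      using Fi[of w x y] target.comp_ident_left[of "Fi w"] target.comp_ident_left[of "Fm w"]
      by (auto simp: inverse_morphisms_def)
  qed auto
  define Fm' where "Fm' X = (let (x, p, y) = (SOME t. t \<in> X) in ?v y p)"
    for X :: "('o \<times> 'm zigzag_step list \<times> 'o) set"
  have Fm'_class: "Fm' (zigzag_class C W x y p) = ?v y p" if "zigzag C W x y p" for x y p
  proof -
    have "(x, p, y) \<in> zigzag_class C W x y p"
      using that by (auto simp: zigzag_class_def intro: zigzag_eq.zigzag_eq_refl)
    then have "(SOME t. t \<in> zigzag_class C W x y p) \<in> zigzag_class C W x y p"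
      by (rule someI)
    then obtain q where "(SOME t. t \<in> zigzag_class C W x y p) = (x, q, y)" "zigzag_eq C W x y p q"
      by (auto simp: zigzag_class_def)
    then show ?thesis
      using v_eq[of x y p q] by (simp add: Fm'_def)
  qed
  have "cat_functor (localization C W) D Fo Fm'"
  proof
    fix f x y assume "f \<in> Hom (localization C W) x y"
    then obtain p where p: "zigzag C W x y p" "f = zigzag_class C W x y p"
      by (auto simp: localization_def)
    then show "Fm' f \<in> Hom D (Fo x) (Fo y)"
      by (simp add: Fm'_class v_hom)
    fix g z assume "g \<in> Hom (localization C W) y z"
    then obtain q where q: "zigzag C W y z q" "g = zigzag_class C W y z q"
      by (auto simp: localization_def)
    show "Fm' (g \<cdot>\<^bsub>localization C W\<^esub> f) = Fm' g \<cdot>\<^bsub>D\<^esub> Fm' f"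
      using v_append[OF p(1) q(1)]
      by (simp add: p q comp_zigzag_class Fm'_class zigzag_append[OF p(1) q(1)])
  next
    fix x assume "x \<in> Obj (localization C W)"
    then show "Fo x \<in> Obj D" and "Fm' (Ident (localization C W) x) = Ident D (Fo x)"
      by (auto simp: localization_def obj_map Fm'_class zigzag_Nil)
  qed
  moreover have "Fm' (localize C W f) = Fm f" if f_mor: "f \<in> Mor C" for f
  proof -
    obtain x y where f: "f \<in> Hom C x y" "x \<in> Obj C" "y \<in> Obj C"
      using f_mor unfolding Mor_def by blast
    then have "zigzag C W x y [Fwd f]"
      by (auto intro!: zigzag.intros)
    then show ?thesis
      using f by (simp add: localize_eq[OF source.category_axioms f(1)] Fm'_class
          target.comp_ident_left[OF hom_map])
  qed
  ultimately show ?thesis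
    by blast
qed

theorem localization_lift_unique:
  assumes C: "category C"
    and F: "cat_functor (localization C W) D Fo Fm" and K: "cat_functor (localization C W) D Ko Km"
    and obj: "\<And>x. x \<in> Obj C \<Longrightarrow> Fo x = Ko x"
    and mor: "\<And>f. f \<in> Mor C \<Longrightarrow> Fm (localize C W f) = Km (localize C W f)"
    and X: "X \<in> Hom (localization C W) x y"
  shows "Fm X = Km X"
proof -
  interpret C: category C by fact
  interpret F: cat_functor "localization C W" D Fo Fm by fact
  interpret K: cat_functor "localization C W" D Ko Km by fact
  have cls: "zigzag_class C W x y p \<in> Hom (localization C W) x y" if "zigzag C W x y p" for x y p
    using that by (auto simp: localization_def)
  have "Fm (zigzag_class C W x y p) = Km (zigzag_class C W x y p)" if "zigzag C W x y p" for x y p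
    using that
  proof induction
    case (zigzag_Nil x)
    then show ?case
      using F.map_ident[of x] K.map_ident[of x] obj by (simp add: localization_def)
  next
    case (zigzag_Fwd f x y z p)
    then have f: "f \<in> Mor C" "zigzag C W x y [Fwd f]"
      using C.hom_obj[of f x y] by (auto simp: Mor_def intro!: zigzag.intros)
    have split: "zigzag_class C W x z (Fwd f # p) =
        zigzag_class C W y z p \<cdot>\<^bsub>localization C W\<^esub> zigzag_class C W x y [Fwd f]"
      using comp_zigzag_class[OF f(2) zigzag_Fwd(2)] by simp
    show ?case
      unfolding split using zigzag_Fwd f mor[OF f(1)] cls
      by (simp add: F.map_comp[OF cls cls] K.map_comp[OF cls cls] localize_eq[OF C])
  next
    case (zigzag_Bwd w y x z p)
    then have xy: "x \<in> Obj C" "y \<in> Obj C" and w: "w \<in> Mor C" "zigzag C W x y [Bwd w]"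
      using C.hom_obj[of w y x] by (auto simp: Mor_def intro!: zigzag.intros)
    have split: "zigzag_class C W x z (Bwd w # p) =
        zigzag_class C W y z p \<cdot>\<^bsub>localization C W\<^esub> zigzag_class C W x y [Bwd w]"
      using comp_zigzag_class[OF w(2) zigzag_Bwd(3)] by simp
    note inv = localize_inverts[OF C zigzag_Bwd(1,2)]
    have xyL: "x \<in> Obj (localization C W)" "y \<in> Obj (localization C W)"
      using xy by (auto simp: localization_def)
    have "inverse_morphisms D (Fo y) (Fo x) (Fm (localize C W w)) (Fm (zigzag_class C W x y [Bwd w]))"
      using inv xyL unfolding inverse_morphisms_def
      by (metis F.hom_map F.map_comp F.map_ident)
    moreover have "inverse_morphisms D (Ko y) (Ko x) (Km (localize C W w)) (Km (zigzag_class C W x y [Bwd w]))"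
      using inv xyL unfolding inverse_morphisms_def
      by (metis K.hom_map K.map_comp K.map_ident)
    ultimately have "Fm (zigzag_class C W x y [Bwd w]) = Km (zigzag_class C W x y [Bwd w])"
      using inverse_morphisms_unique[OF F.target.category_axioms] obj xy mor[OF w(1)] by metis
    then show ?case
      unfolding split using zigzag_Bwd w
      by (simp add: F.map_comp[OF cls cls] K.map_comp[OF cls cls])
  qed
  then show ?thesis
    using X by (auto simp: localization_def)
qed

section \<open>Model structures\<close>

definition retract_of :: "('o, 'm) cat \<Rightarrow> 'm \<Rightarrow> 'm \<Rightarrow> bool" where
  "retract_of C f g \<longleftrightarrow> (\<exists>a b c d i r j s.
     f \<in> Hom C a b \<and> g \<in> Hom C c d \<and>
     i \<in> Hom C a c \<and> r \<in> Hom C c a \<and> r \<cdot>\<^bsub>C\<^esub> i = Ident C a \<and>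
     j \<in> Hom C b d \<and> s \<in> Hom C d b \<and> s \<cdot>\<^bsub>C\<^esub> j = Ident C b \<and>
     g \<cdot>\<^bsub>C\<^esub> i = j \<cdot>\<^bsub>C\<^esub> f \<and> f \<cdot>\<^bsub>C\<^esub> r = s \<cdot>\<^bsub>C\<^esub> g)"

definition lifts_against :: "('o, 'm) cat \<Rightarrow> 'm \<Rightarrow> 'm \<Rightarrow> bool" where
  "lifts_against C i p \<longleftrightarrow> (\<forall>a b x y u v.
     i \<in> Hom C a b \<longrightarrow> p \<in> Hom C x y \<longrightarrow> u \<in> Hom C a x \<longrightarrow> v \<in> Hom C b y \<longrightarrow>
     p \<cdot>\<^bsub>C\<^esub> u = v \<cdot>\<^bsub>C\<^esub> i \<longrightarrow>
     (\<exists>h \<in> Hom C b x. h \<cdot>\<^bsub>C\<^esub> i = u \<and> p \<cdot>\<^bsub>C\<^esub> h = v))"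

locale model_structure = category C for C :: "('o, 'm) cat" (structure) +
  fixes Cofib Fib Weq :: "'m set"
  assumes classes: "Cofib \<subseteq> Mor C" "Fib \<subseteq> Mor C" "Weq \<subseteq> Mor C"
    and two_of_three:
      "f \<in> Hom C x y \<Longrightarrow> g \<in> Hom C y z \<Longrightarrow> f \<in> Weq \<Longrightarrow> g \<in> Weq \<Longrightarrow> g \<cdot> f \<in> Weq"
      "f \<in> Hom C x y \<Longrightarrow> g \<in> Hom C y z \<Longrightarrow> f \<in> Weq \<Longrightarrow> g \<cdot> f \<in> Weq \<Longrightarrow> g \<in> Weq"
      "f \<in> Hom C x y \<Longrightarrow> g \<in> Hom C y z \<Longrightarrow> g \<in> Weq \<Longrightarrow> g \<cdot> f \<in> Weq \<Longrightarrow> f \<in> Weq"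
    and retracts:
      "retract_of C f g \<Longrightarrow> g \<in> Cofib \<Longrightarrow> f \<in> Cofib"
      "retract_of C f g \<Longrightarrow> g \<in> Fib \<Longrightarrow> f \<in> Fib"
      "retract_of C f g \<Longrightarrow> g \<in> Weq \<Longrightarrow> f \<in> Weq"
    and lifting:
      "i \<in> Cofib \<Longrightarrow> p \<in> Fib \<inter> Weq \<Longrightarrow> lifts_against C i p"
      "i \<in> Cofib \<inter> Weq \<Longrightarrow> p \<in> Fib \<Longrightarrow> lifts_against C i p"
    and factorization:
      "f \<in> Hom C x y \<Longrightarrow>
         \<exists>z i p. i \<in> Hom C x z \<and> p \<in> Hom C z y \<and> p \<cdot> i = f \<and> i \<in> Cofib \<and> p \<in> Fib \<inter> Weq"
      "f \<in> Hom C x y \<Longrightarrow>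
         \<exists>z i p. i \<in> Hom C x z \<and> p \<in> Hom C z y \<and> p \<cdot> i = f \<and> i \<in> Cofib \<inter> Weq \<and> p \<in> Fib"

text \<open>In the next three definitions \<open>z\<close> ranges over the (mutually isomorphic) zero objects; the
  classes of a model structure contain the isomorphisms between them, so the choice is immaterial.\<close>

definition cofibrant_objects :: "('o, 'm) cat \<Rightarrow> 'm set \<Rightarrow> 'o set" where
  "cofibrant_objects C Cofib =
     {x \<in> Obj C. \<exists>z. zero_object C z \<and> (\<exists>f \<in> Hom C z x. f \<in> Cofib)}"

definition fibrant_objects :: "('o, 'm) cat \<Rightarrow> 'm set \<Rightarrow> 'o set" where
  "fibrant_objects C Fib =
     {x \<in> Obj C. \<exists>z. zero_object C z \<and> (\<exists>f \<in> Hom C x z. f \<in> Fib)}"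

definition trivial_objects :: "('o, 'm) cat \<Rightarrow> 'm set \<Rightarrow> 'o set" where
  "trivial_objects C Weq =
     {x \<in> Obj C. \<exists>z. zero_object C z \<and> (\<exists>f \<in> Hom C z x. f \<in> Weq)}"

abbreviation Ho :: "('o, 'm) cat \<Rightarrow> 'm set \<Rightarrow> ('o, ('o \<times> 'm zigzag_step list \<times> 'o) set) cat" where
  "Ho C Weq \<equiv> localization C Weq"

end

(* Two maps out of a cofibrant object that agree after a trivial fibration differ by a map that
   factors through an object of C \<inter> F \<inter> W: their difference extends over the cofibration part of a
   factorization of x \<rightarrow> 0. With the dual statement this makes x \<mapsto> R Q x (cofibrant, then fibrant
   replacement) a well defined functor from A to the quotient which inverts weak equivalences.
   Conversely the quotient maps to Ho(A), because objects of W are killed there. Choosing the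
   replacement of an object of C \<inter> F to be the object itself makes one composite strictly the
   identity; the other is naturally isomorphic to the identity via x \<leftarrow> Q x \<rightarrow> R Q x. The additive
   structure of Ho(A) is transported along this equivalence. *)

theory Submission
  imports Defs
begin

section \<open>Functors and equivalences\<close>

text \<open>Before the equivalence is known, \<open>Ho C Weq\<close> carries no addition, so
  "objects of W are killed" cannot mean that a difference of two maps becomes zero there. The usable
  form is that \<open>g\<close> and \<open>h k + g\<close> have the same image when
  \<open>h k\<close> passes through a fibrant trivial object \<open>t\<close>; it comes from
  inverting the single trivial fibration \<open>x \<oplus> t \<rightarrow> x\<close>. Everything
  else about the three classes is drawn from lifting properties. By the retract argument a map is a
  cofibration (trivial cofibration) once it lifts against all trivial fibrations (all fibrations).
  Hence \<open>C\<close> consists of the objects projective for trivial fibrations, and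
  \<open>C \<inter> W\<close> of those projective for all fibrations; closure under biproducts and
  along cofibrations follows from this. The fibrant side is obtained in the opposite category. The
  addition can be transported because the functor to the quotient is bijective on hom-sets: a sum in
  \<open>Ho C Weq\<close> is the unique preimage of a sum of cosets.\<close>

lemma (in category) inverse_morphisms_ident:
  "x \<in> Obj C \<Longrightarrow> inverse_morphisms C x x (Ident C x) (Ident C x)"
  using ident_hom comp_ident_left unfolding inverse_morphisms_def by blast

lemma inverse_morphisms_sym: "inverse_morphisms C x y f g \<Longrightarrow> inverse_morphisms C y x g f"
  unfolding inverse_morphisms_def by blast

lemma (in category) inverse_morphisms_comp:
  assumes "inverse_morphisms C x y f f'" "inverse_morphisms C y z g g'"
  shows "inverse_morphisms C x z (g \<cdot> f) (f' \<cdot> g')"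
proof -
  have fg: "f \<in> Hom C x y" "f' \<in> Hom C y x" "g \<in> Hom C y z" "g' \<in> Hom C z y"
    and eq: "f' \<cdot> f = Ident C x" "f \<cdot> f' = Ident C y" "g' \<cdot> g = Ident C y" "g \<cdot> g' = Ident C z"
    using assms unfolding inverse_morphisms_def by auto
  have "(f' \<cdot> g') \<cdot> (g \<cdot> f) = f' \<cdot> ((g' \<cdot> g) \<cdot> f)"
    using comp_assoc[OF comp_hom[OF fg(1,3)] fg(4,2)] comp_assoc[OF fg(1,3,4)] by simp
  moreover have "(g \<cdot> f) \<cdot> (f' \<cdot> g') = g \<cdot> ((f \<cdot> f') \<cdot> g')"
    using comp_assoc[OF comp_hom[OF fg(4,2)] fg(1,3)] comp_assoc[OF fg(4,2,1)] by simp
  ultimately show ?thesis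
    using fg eq comp_hom unfolding inverse_morphisms_def by (simp add: comp_ident_left)
qed

lemma (in category) iso_cancel_left:
  assumes "inverse_morphisms C y z g g'" "f \<in> Hom C x y" "f' \<in> Hom C x y" "g \<cdot> f = g \<cdot> f'"
  shows "f = f'"
proof -
  have g: "g \<in> Hom C y z" "g' \<in> Hom C z y" "g' \<cdot> g = Ident C y"
    using assms(1) unfolding inverse_morphisms_def by auto
  have "f = g' \<cdot> (g \<cdot> f)"
    using comp_assoc[OF assms(2) g(1,2)] comp_ident_left[OF assms(2)] g(3) by simp
  then show ?thesis
    using comp_assoc[OF assms(3) g(1,2)] comp_ident_left[OF assms(3)] g(3) assms(4) by simp
qed

lemma (in category) iso_cancel_right:
  assumes "inverse_morphisms C x y g g'" "f \<in> Hom C y z" "f' \<in> Hom C y z" "f \<cdot> g = f' \<cdot> g"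
  shows "f = f'"
proof -
  have g: "g \<in> Hom C x y" "g' \<in> Hom C y x" "g \<cdot> g' = Ident C y"
    using assms(1) unfolding inverse_morphisms_def by auto
  have "f = (f \<cdot> g) \<cdot> g'"
    using comp_assoc[OF g(2,1) assms(2)] comp_ident_right[OF assms(2)] g(3) by simp
  then show ?thesis
    using comp_assoc[OF g(2,1) assms(3)] comp_ident_right[OF assms(3)] g(3) assms(4) by simp
qed

section \<open>Ways of obtaining functors\<close>

lemma cat_functor_comp:
  assumes F: "cat_functor C D Fo Fm" and K: "cat_functor D E Ko Km"
  shows "cat_functor C E (Ko \<circ> Fo) (Km \<circ> Fm)"
proof -
  interpret F: cat_functor C D Fo Fm by fact
  interpret K: cat_functor D E Ko Km by fact
  show ?thesis
    by unfold_locales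
      (simp_all add: F.obj_map K.obj_map F.hom_map K.hom_map F.map_ident K.map_ident F.map_comp
        K.map_comp[OF F.hom_map F.hom_map])
qed

text \<open>Serves functors whose values depend on a choice (of a lift, of a coset representative):
  uniqueness turns the relation into a map. \<open>\<Phi>\<close> carries the endpoints because a
  bare morphism does not; disjointness of hom-sets makes the endpoints found by \<open>SOME\<close>
  the intended ones.\<close>

lemma functor_of_relation:
  assumes C: "category C" and D: "category D"
    and obj: "\<And>x. x \<in> Obj C \<Longrightarrow> Fo x \<in> Obj D"
    and ex: "\<And>x y f. f \<in> Hom C x y \<Longrightarrow> \<exists>h. \<Phi> x y f h"
    and hom: "\<And>x y f h. f \<in> Hom C x y \<Longrightarrow> \<Phi> x y f h \<Longrightarrow> h \<in> Hom D (Fo x) (Fo y)"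
    and uniq: "\<And>x y f h h'. f \<in> Hom C x y \<Longrightarrow> \<Phi> x y f h \<Longrightarrow> \<Phi> x y f h' \<Longrightarrow> h = h'"
    and ident: "\<And>x. x \<in> Obj C \<Longrightarrow> \<Phi> x x (Ident C x) (Ident D (Fo x))"
    and comp: "\<And>x y z f g h k. f \<in> Hom C x y \<Longrightarrow> g \<in> Hom C y z \<Longrightarrow> \<Phi> x y f h \<Longrightarrow> \<Phi> y z g k \<Longrightarrow>
        \<Phi> x z (g \<cdot>\<^bsub>C\<^esub> f) (k \<cdot>\<^bsub>D\<^esub> h)"
  shows "\<exists>Fm. cat_functor C D Fo Fm \<and> (\<forall>x y f h. f \<in> Hom C x y \<longrightarrow> \<Phi> x y f h \<longrightarrow> Fm f = h)"
proof -
  interpret C: category C by fact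
  interpret D: category D by fact
  define Fm where "Fm f = (SOME h. \<exists>x y. f \<in> Hom C x y \<and> \<Phi> x y f h)" for f
  have \<Phi>: "\<Phi> x y f (Fm f)" if "f \<in> Hom C x y" for x y f
  proof -
    have "\<exists>a b. f \<in> Hom C a b \<and> \<Phi> a b f (Fm f)"
      unfolding Fm_def by (rule someI_ex) (use ex that in blast)
    then show ?thesis
      using C.hom_disjoint that by blast
  qed
  then have eq: "Fm f = h" if "f \<in> Hom C x y" "\<Phi> x y f h" for x y f h
    using that uniq by blast
  have "cat_functor C D Fo Fm"
  proof
    show "Fm (g \<cdot>\<^bsub>C\<^esub> f) = Fm g \<cdot>\<^bsub>D\<^esub> Fm f" if "f \<in> Hom C x y" "g \<in> Hom C y z" for x y z f g
      using comp[OF that \<Phi> \<Phi>] that eq C.comp_hom by blast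
  qed (use obj hom \<Phi> eq ident C.ident_hom in blast)+
  then show ?thesis
    using eq by blast
qed

section \<open>Arithmetic of morphisms in a preadditive category\<close>

lemma (in preadditive_category) zero_hom:
  "x \<in> Obj C \<Longrightarrow> y \<in> Obj C \<Longrightarrow> \<one>\<^bsub>G x y\<^esub> \<in> Hom C x y"
  using hom_comm_group carrier_hom comm_group.axioms(2) group.is_monoid monoid.one_closed by metis

lemma (in preadditive_category) add_hom:
  assumes "f \<in> Hom C x y" "g \<in> Hom C x y"
  shows "f \<otimes>\<^bsub>G x y\<^esub> g \<in> Hom C x y"
proof -
  interpret comm_group "G x y" using assms hom_comm_group hom_obj by blast
  show ?thesis using assms m_closed carrier_hom hom_obj by metis
qed

lemma (in preadditive_category) comp_add:
  assumes "f \<in> Hom C x y" "f' \<in> Hom C x y" "g \<in> Hom C y z"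
  shows "g \<cdot> (f \<otimes>\<^bsub>G x y\<^esub> f') = (g \<cdot> f) \<otimes>\<^bsub>G x z\<^esub> (g \<cdot> f')"
proof -
  have "x \<in> Obj C" "y \<in> Obj C"
    using assms hom_obj by auto
  then show ?thesis
    using hom_mult[OF comp_add_right[OF assms(3)]] assms carrier_hom by simp
qed

lemma (in preadditive_category) add_comp:
  assumes "f \<in> Hom C x y" "g \<in> Hom C y z" "g' \<in> Hom C y z"
  shows "(g \<otimes>\<^bsub>G y z\<^esub> g') \<cdot> f = (g \<cdot> f) \<otimes>\<^bsub>G x z\<^esub> (g' \<cdot> f)"
proof -
  have "z \<in> Obj C" "y \<in> Obj C"
    using assms hom_obj by auto
  then show ?thesis
    using hom_mult[OF comp_add_left[OF assms(1)]] assms carrier_hom by simp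
qed

lemma (in preadditive_category) comp_inv:
  assumes f: "f \<in> Hom C x y" and g: "g \<in> Hom C y z"
  shows "g \<cdot> inv\<^bsub>G x y\<^esub> f = inv\<^bsub>G x z\<^esub> (g \<cdot> f)"
proof -
  have o: "x \<in> Obj C" "y \<in> Obj C" "z \<in> Obj C"
    using f g hom_obj by auto
  then have "group_hom (G x y) (G x z) (\<lambda>f. g \<cdot> f)"
    using comp_add_right[OF g] hom_comm_group
    by (simp add: group_hom_def group_hom_axioms_def comm_group.axioms)
  then show ?thesis
    using group_hom.hom_inv f o carrier_hom by metis
qed

lemma (in preadditive_category) comp_zero:
  assumes g: "g \<in> Hom C y z" and x: "x \<in> Obj C"
  shows "g \<cdot> \<one>\<^bsub>G x y\<^esub> = \<one>\<^bsub>G x z\<^esub>"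
proof -
  have "group_hom (G x y) (G x z) (\<lambda>f. g \<cdot> f)"
    using comp_add_right[OF g] hom_comm_group x hom_obj[OF g]
    by (simp add: group_hom_def group_hom_axioms_def comm_group.axioms)
  then show ?thesis
    using group_hom.hom_one by blast
qed

lemma (in preadditive_category) zero_comp:
  assumes f: "f \<in> Hom C x y" and z: "z \<in> Obj C"
  shows "\<one>\<^bsub>G y z\<^esub> \<cdot> f = \<one>\<^bsub>G x z\<^esub>"
proof -
  have "group_hom (G y z) (G x z) (\<lambda>g. g \<cdot> f)"
    using comp_add_left[OF f] hom_comm_group z hom_obj[OF f]
    by (simp add: group_hom_def group_hom_axioms_def comm_group.axioms)
  then show ?thesis
    using group_hom.hom_one by blast
qed

text \<open>The hypotheses make \<open>Km\<close> bijective on hom-sets, so the addition of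
  \<open>D\<close> can be pulled back in just one way that makes \<open>Km\<close> additive. Every
  law in \<open>L\<close> is checked after applying \<open>Km\<close>. Zero objects and biproducts
  of \<open>L\<close> sit at \<open>Jo\<close>-images of those of \<open>D\<close>, since
  \<open>Ko\<close> undoes \<open>Jo\<close> on the nose.\<close>

lemma additive_along_equivalence:
  fixes L :: "('o, 'm) cat" and D :: "('p, 'n) cat"
  assumes K: "cat_functor L D Ko Km" and J: "cat_functor D L Jo Jm"
    and H: "additive_category D H"
    and KJo: "\<And>x. x \<in> Obj D \<Longrightarrow> Ko (Jo x) = x"
    and KJm: "\<And>f x y. f \<in> Hom D x y \<Longrightarrow> Km (Jm f) = f"
    and JK: "naturally_isomorphic L L id id (Jo \<circ> Ko) (Jm \<circ> Km)"
  shows "\<exists>H'. additive_category L H' \<and> additively_equivalent L H' D H"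
proof -
  interpret D: additive_category D H by fact
  interpret K: cat_functor L D Ko Km by fact
  interpret J: cat_functor D L Jo Jm by fact
  obtain \<eta> where "\<forall>x\<in>Obj L. isomorphism L (id x) ((Jo \<circ> Ko) x) (\<eta> x)"
    and "\<forall>x y f. f \<in> Hom L x y \<longrightarrow> (Jm \<circ> Km) f \<cdot>\<^bsub>L\<^esub> \<eta> x = \<eta> y \<cdot>\<^bsub>L\<^esub> id f"
    using JK unfolding naturally_isomorphic_def by blast
  then have ex: "\<forall>x\<in>Obj L. \<exists>e. inverse_morphisms L x (Jo (Ko x)) (\<eta> x) e"
    and "\<forall>x y f. f \<in> Hom L x y \<longrightarrow> Jm (Km f) \<cdot>\<^bsub>L\<^esub> \<eta> x = \<eta> y \<cdot>\<^bsub>L\<^esub> f"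
    unfolding isomorphism_def by auto
  then have nat: "Jm (Km f) \<cdot>\<^bsub>L\<^esub> \<eta> x = \<eta> y \<cdot>\<^bsub>L\<^esub> f" if "f \<in> Hom L x y" for x y f
    using that by blast
  from ex obtain \<epsilon> where inv: "\<And>x. x \<in> Obj L \<Longrightarrow> inverse_morphisms L x (Jo (Ko x)) (\<eta> x) (\<epsilon> x)"
    by metis
  \<comment> \<open>Naturality gives \<open>\<eta> y \<cdot> f = Jm (Km f) \<cdot> \<eta> x\<close>,
    and \<open>\<eta> y\<close> can be cancelled.\<close>
  have faithful: "f = g" if f: "f \<in> Hom L x y" and g: "g \<in> Hom L x y" and "Km f = Km g" for x y f g
    using K.source.iso_cancel_left[OF inv f g] K.source.hom_obj[OF f] nat[OF f] nat[OF g] that(3)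
    by simp
  have full: "\<exists>f \<in> Hom L x y. Km f = h"
    if h: "h \<in> Hom D (Ko x) (Ko y)" and x: "x \<in> Obj L" and y: "y \<in> Obj L" for x y h
  proof -
    \<comment> \<open>The preimage is \<open>Jm h\<close> conjugated by the natural isomorphism.
      Cancelling \<open>\<eta> x\<close> in its naturality square gives
      \<open>Jm (Km f) = Jm h\<close>, and \<open>Km\<close> undoes \<open>Jm\<close>.\<close>
    define f where "f = \<epsilon> y \<cdot>\<^bsub>L\<^esub> (Jm h \<cdot>\<^bsub>L\<^esub> \<eta> x)"
    have e: "\<eta> x \<in> Hom L x (Jo (Ko x))" "\<epsilon> y \<in> Hom L (Jo (Ko y)) y" "\<eta> y \<in> Hom L y (Jo (Ko y))"
      "\<eta> y \<cdot>\<^bsub>L\<^esub> \<epsilon> y = Ident L (Jo (Ko y))"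
      using inv x y unfolding inverse_morphisms_def by auto
    have he: "Jm h \<cdot>\<^bsub>L\<^esub> \<eta> x \<in> Hom L x (Jo (Ko y))"
      using J.hom_map[OF h] e K.source.comp_hom by blast
    have f: "f \<in> Hom L x y"
      unfolding f_def using he e K.source.comp_hom by blast
    have "Jm (Km f) \<cdot>\<^bsub>L\<^esub> \<eta> x = (\<eta> y \<cdot>\<^bsub>L\<^esub> \<epsilon> y) \<cdot>\<^bsub>L\<^esub> (Jm h \<cdot>\<^bsub>L\<^esub> \<eta> x)"
      using nat[OF f] K.source.comp_assoc[OF he e(2,3)] f_def by simp
    then have "Jm (Km f) \<cdot>\<^bsub>L\<^esub> \<eta> x = Jm h \<cdot>\<^bsub>L\<^esub> \<eta> x"
      using e(4) K.source.comp_ident_left[OF he] by simp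
    then have "Jm (Km f) = Jm h"
      using K.source.iso_cancel_right[OF inv[OF x] J.hom_map[OF K.hom_map[OF f]] J.hom_map[OF h]]
      by simp
    then have "Km f = h"
      using KJm[OF K.hom_map[OF f]] KJm[OF h] by metis
    with f show ?thesis by blast
  qed
  define lift where "lift x y h = (THE f. f \<in> Hom L x y \<and> Km f = h)" for x y h
  have lift: "lift x y h \<in> Hom L x y \<and> Km (lift x y h) = h"
    if "h \<in> Hom D (Ko x) (Ko y)" "x \<in> Obj L" "y \<in> Obj L" for x y h
    unfolding lift_def by (rule theI') (use full[OF that] faithful in blast)
  define H' where "H' x y = \<lparr>carrier = Hom L x y,
      monoid.mult = (\<lambda>f g. lift x y (Km f \<otimes>\<^bsub>H (Ko x) (Ko y)\<^esub> Km g)),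
      one = lift x y \<one>\<^bsub>H (Ko x) (Ko y)\<^esub>\<rparr>" for x y
  have H'_simps: "carrier (H' x y) = Hom L x y"
    "f \<otimes>\<^bsub>H' x y\<^esub> g = lift x y (Km f \<otimes>\<^bsub>H (Ko x) (Ko y)\<^esub> Km g)"
    "\<one>\<^bsub>H' x y\<^esub> = lift x y \<one>\<^bsub>H (Ko x) (Ko y)\<^esub>" for x y f g
    by (auto simp: H'_def)
  have add: "f \<otimes>\<^bsub>H' x y\<^esub> g \<in> Hom L x y" "Km (f \<otimes>\<^bsub>H' x y\<^esub> g) = Km f \<otimes>\<^bsub>H (Ko x) (Ko y)\<^esub> Km g"
    if "f \<in> Hom L x y" "g \<in> Hom L x y" for x y f g
    using that lift D.add_hom K.hom_map K.source.hom_obj by (auto simp: H'_simps)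
  have zero: "\<one>\<^bsub>H' x y\<^esub> \<in> Hom L x y" "Km \<one>\<^bsub>H' x y\<^esub> = \<one>\<^bsub>H (Ko x) (Ko y)\<^esub>"
    if "x \<in> Obj L" "y \<in> Obj L" for x y
    using that lift D.zero_hom K.obj_map by (auto simp: H'_simps)
  have L: "preadditive_category L H'"
  proof (rule preadditive_category.intro[OF K.source.category_axioms preadditive_category_axioms.intro])
    fix x y assume xy: "x \<in> Obj L" "y \<in> Obj L"
    interpret HD: comm_group "H (Ko x) (Ko y)"
      using xy D.hom_comm_group K.obj_map by blast
    have Kc: "Km f \<in> carrier (H (Ko x) (Ko y))" if "f \<in> Hom L x y" for f
      using K.hom_map[OF that] D.carrier_hom K.obj_map xy by blast
    show "comm_group (H' x y)"
    proof (rule comm_groupI)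
      fix f assume "f \<in> carrier (H' x y)"
      then have f: "f \<in> Hom L x y" by (simp add: H'_simps)
      show "\<one>\<^bsub>H' x y\<^esub> \<otimes>\<^bsub>H' x y\<^esub> f = f"
        using faithful[OF _ f] add zero[OF xy] Kc[OF f] f by auto
      have "inv\<^bsub>H (Ko x) (Ko y)\<^esub> Km f \<in> Hom D (Ko x) (Ko y)"
        using HD.inv_closed[OF Kc[OF f]] D.carrier_hom K.obj_map xy by blast
      then obtain g where g: "g \<in> Hom L x y" "Km g = inv\<^bsub>H (Ko x) (Ko y)\<^esub> Km f"
        using full xy by blast
      have "g \<otimes>\<^bsub>H' x y\<^esub> f = \<one>\<^bsub>H' x y\<^esub>"
        by (rule faithful[of _ x y]) (use add zero[OF xy] Kc[OF f] f g in auto)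
      then show "\<exists>g\<in>carrier (H' x y). g \<otimes>\<^bsub>H' x y\<^esub> f = \<one>\<^bsub>H' x y\<^esub>"
        using g by (auto simp: H'_simps(1))
      fix g assume "g \<in> carrier (H' x y)"
      then have g: "g \<in> Hom L x y" by (simp add: H'_simps)
      show "f \<otimes>\<^bsub>H' x y\<^esub> g \<in> carrier (H' x y)"
        using add f g by (simp add: H'_simps(1))
      show "f \<otimes>\<^bsub>H' x y\<^esub> g = g \<otimes>\<^bsub>H' x y\<^esub> f"
        by (rule faithful[of _ x y]) (use add f g Kc HD.m_comm in auto)
      fix h assume "h \<in> carrier (H' x y)"
      then have h: "h \<in> Hom L x y" by (simp add: H'_simps)
      show "f \<otimes>\<^bsub>H' x y\<^esub> g \<otimes>\<^bsub>H' x y\<^esub> h = f \<otimes>\<^bsub>H' x y\<^esub> (g \<otimes>\<^bsub>H' x y\<^esub> h)"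
        by (rule faithful[of _ x y]) (use add f g h Kc HD.m_assoc in auto)
    qed (use zero[OF xy] in \<open>simp add: H'_simps(1)\<close>)
    show "carrier (H' x y) = Hom L x y"
      by (rule H'_simps)
  next
    fix g y z x assume g: "g \<in> Hom L y z" and x: "x \<in> Obj L"
    show "(\<lambda>f. g \<cdot>\<^bsub>L\<^esub> f) \<in> hom (H' x y) (H' x z)"
    proof (rule homI)
      show "g \<cdot>\<^bsub>L\<^esub> f \<in> carrier (H' x z)" if "f \<in> carrier (H' x y)" for f
        using that g K.source.comp_hom by (auto simp: H'_simps(1))
      show "g \<cdot>\<^bsub>L\<^esub> (f \<otimes>\<^bsub>H' x y\<^esub> f') = (g \<cdot>\<^bsub>L\<^esub> f) \<otimes>\<^bsub>H' x z\<^esub> (g \<cdot>\<^bsub>L\<^esub> f')"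
        if "f \<in> carrier (H' x y)" "f' \<in> carrier (H' x y)" for f f'
      proof (rule faithful[of _ x z])
        have f: "f \<in> Hom L x y" "f' \<in> Hom L x y" using that by (auto simp: H'_simps(1))
        note gf = K.source.comp_hom[OF f(1) g] K.source.comp_hom[OF f(2) g]
        show "Km (g \<cdot>\<^bsub>L\<^esub> (f \<otimes>\<^bsub>H' x y\<^esub> f')) = Km ((g \<cdot>\<^bsub>L\<^esub> f) \<otimes>\<^bsub>H' x z\<^esub> (g \<cdot>\<^bsub>L\<^esub> f'))"
          using add(2)[OF gf] K.map_comp[OF f(1) g] K.map_comp[OF f(2) g]
            K.map_comp[OF add(1)[OF f] g] add(2)[OF f] D.comp_add[OF f[THEN K.hom_map] K.hom_map[OF g]]
          by simp
      qed (use that g K.source.comp_hom[of _ x y g z] add in \<open>auto simp: H'_simps(1)\<close>)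
    qed
  next
    fix f x y z assume f: "f \<in> Hom L x y" and z: "z \<in> Obj L"
    show "(\<lambda>g. g \<cdot>\<^bsub>L\<^esub> f) \<in> hom (H' y z) (H' x z)"
    proof (rule homI)
      show "g \<cdot>\<^bsub>L\<^esub> f \<in> carrier (H' x z)" if "g \<in> carrier (H' y z)" for g
        using that f K.source.comp_hom by (auto simp: H'_simps(1))
      show "(g \<otimes>\<^bsub>H' y z\<^esub> g') \<cdot>\<^bsub>L\<^esub> f = (g \<cdot>\<^bsub>L\<^esub> f) \<otimes>\<^bsub>H' x z\<^esub> (g' \<cdot>\<^bsub>L\<^esub> f)"
        if "g \<in> carrier (H' y z)" "g' \<in> carrier (H' y z)" for g g'
      proof (rule faithful[of _ x z])
        have g: "g \<in> Hom L y z" "g' \<in> Hom L y z" using that by (auto simp: H'_simps(1))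
        note gf = K.source.comp_hom[OF f g(1)] K.source.comp_hom[OF f g(2)]
        show "Km ((g \<otimes>\<^bsub>H' y z\<^esub> g') \<cdot>\<^bsub>L\<^esub> f) = Km ((g \<cdot>\<^bsub>L\<^esub> f) \<otimes>\<^bsub>H' x z\<^esub> (g' \<cdot>\<^bsub>L\<^esub> f))"
          using add(2)[OF gf] K.map_comp[OF f g(1)] K.map_comp[OF f g(2)]
            K.map_comp[OF f add(1)[OF g]] add(2)[OF g] D.add_comp[OF K.hom_map[OF f] g[THEN K.hom_map]]
          by simp
      qed (use that f K.source.comp_hom[of f x y _ z] add in \<open>auto simp: H'_simps(1)\<close>)
    qed
  qed
  interpret L: preadditive_category L H' by fact
  have "additive_category L H'"
  proof
    obtain z where z: "zero_object D z"
      using D.ex_zero_object by blast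
    then have zD: "z \<in> Obj D" unfolding zero_object_def by blast
    have "zero_object L (Jo z)"
      unfolding zero_object_def
    proof (intro conjI ballI)
      show "Jo z \<in> Obj L" using J.obj_map zD .
      fix x assume x: "x \<in> Obj L"
      have "\<exists>!f. f \<in> Hom D (Ko (Jo z)) (Ko x)" "\<exists>!f. f \<in> Hom D (Ko x) (Ko (Jo z))"
        using z K.obj_map[OF x] unfolding zero_object_def KJo[OF zD] by blast+
      then show "\<exists>!f. f \<in> Hom L (Jo z) x" "\<exists>!f. f \<in> Hom L x (Jo z)"
        using full x J.obj_map[OF zD] faithful K.hom_map by metis+
    qed
    then show "\<exists>z. zero_object L z" by blast
    fix x y assume xy: "x \<in> Obj L" "y \<in> Obj L"
    then obtain b i j p q where b: "biproduct D H (Ko x) (Ko y) b i j p q"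
      using D.ex_biproduct K.obj_map by blast
    \<comment> \<open>The legs are retyped with \<open>Ko (Jo b)\<close> in place of
      \<open>b\<close>, the form in which \<open>full\<close> can pull them back to
      \<open>L\<close>.\<close>
    then have bD: "b \<in> Obj D" and ijpq: "i \<in> Hom D (Ko x) (Ko (Jo b))" "j \<in> Hom D (Ko y) (Ko (Jo b))"
      "p \<in> Hom D (Ko (Jo b)) (Ko x)" "q \<in> Hom D (Ko (Jo b)) (Ko y)"
      using D.hom_obj KJo unfolding biproduct_def by auto
    note bL = J.obj_map[OF bD]
    note KJb = KJo[OF bD]
    obtain i' j' p' q' where l: "i' \<in> Hom L x (Jo b)" "Km i' = i" "j' \<in> Hom L y (Jo b)" "Km j' = j"
      "p' \<in> Hom L (Jo b) x" "Km p' = p" "q' \<in> Hom L (Jo b) y" "Km q' = q"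
      using full[OF ijpq(1) xy(1) bL] full[OF ijpq(2) xy(2) bL] full[OF ijpq(3) bL xy(1)]
        full[OF ijpq(4) bL xy(2)] by metis
    note c = K.source.comp_hom[OF l(1,5)] K.source.comp_hom[OF l(3,7)] K.source.comp_hom[OF l(1,7)] K.source.comp_hom[OF l(3,5)]
      K.source.comp_hom[OF l(5,1)] K.source.comp_hom[OF l(7,3)]
    have "biproduct L H' x y (Jo b) i' j' p' q'"
      unfolding biproduct_def
    proof (intro conjI)
      show "p' \<cdot>\<^bsub>L\<^esub> i' = Ident L x" "q' \<cdot>\<^bsub>L\<^esub> j' = Ident L y"
        "q' \<cdot>\<^bsub>L\<^esub> i' = \<one>\<^bsub>H' x y\<^esub>" "p' \<cdot>\<^bsub>L\<^esub> j' = \<one>\<^bsub>H' y x\<^esub>"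
        using b xy c l K.map_comp[OF l(1,5)] K.map_comp[OF l(3,7)] K.map_comp[OF l(1,7)]
          K.map_comp[OF l(3,5)] K.map_ident zero K.source.ident_hom faithful unfolding biproduct_def by metis+
      show "(i' \<cdot>\<^bsub>L\<^esub> p') \<otimes>\<^bsub>H' (Jo b) (Jo b)\<^esub> (j' \<cdot>\<^bsub>L\<^esub> q') = Ident L (Jo b)"
      proof (rule faithful)
        show "Km ((i' \<cdot>\<^bsub>L\<^esub> p') \<otimes>\<^bsub>H' (Jo b) (Jo b)\<^esub> (j' \<cdot>\<^bsub>L\<^esub> q')) = Km (Ident L (Jo b))"
          using b add(2)[OF c(5,6)] K.map_comp[OF l(5,1)] K.map_comp[OF l(7,3)] K.map_ident[OF bL] KJb l
          unfolding biproduct_def by simp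
      qed (use add(1)[OF c(5,6)] K.source.ident_hom[OF bL] in auto)
    qed (use l in auto)
    then show "\<exists>b i j p q. biproduct L H' x y b i j p q" by blast
  qed
  then interpret L: additive_category L H' .
  have "additive_functor L H' D H Ko Km"
  proof
    show "Km \<in> hom (H' x y) (H (Ko x) (Ko y))" if "x \<in> Obj L" "y \<in> Obj L" for x y
      by (rule homI)
        (use that add K.hom_map in \<open>auto simp: H'_simps(1) D.carrier_hom K.obj_map\<close>)
  qed
  moreover have "additive_functor D H L H' Jo Jm"
  proof
    show "Jm \<in> hom (H x y) (H' (Jo x) (Jo y))" if xy: "x \<in> Obj D" "y \<in> Obj D" for x y
    proof (rule homI)
      show "Jm f \<in> carrier (H' (Jo x) (Jo y))" if "f \<in> carrier (H x y)" for f
        using that xy J.hom_map by (auto simp: H'_simps(1) D.carrier_hom)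
      fix f g assume "f \<in> carrier (H x y)" "g \<in> carrier (H x y)"
      then have fg: "f \<in> Hom D x y" "g \<in> Hom D x y"
        using xy by (auto simp: D.carrier_hom)
      show "Jm (f \<otimes>\<^bsub>H x y\<^esub> g) = Jm f \<otimes>\<^bsub>H' (Jo x) (Jo y)\<^esub> Jm g"
        by (rule faithful)
          (use fg xy KJo KJm D.add_hom[OF fg] J.hom_map add[OF fg[THEN J.hom_map]] in auto)
    qed
  qed
  moreover have "naturally_isomorphic D D (Ko \<circ> Jo) (Km \<circ> Jm) id id"
    unfolding naturally_isomorphic_def isomorphism_def
    using D.inverse_morphisms_ident KJo KJm D.comp_ident_left D.comp_ident_right
    by (intro exI[of _ "Ident D"]) fastforce
  ultimately show ?thesis
    using JK L.additive_category_axioms H unfolding additively_equivalent_def by blast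
qed

section \<open>Full subcategories, quotients and opposites\<close>

text \<open>The morphisms themselves are kept, so dualizing a model structure merely exchanges the
  sets \<open>Cofib\<close> and \<open>Fib\<close>, and statements about fibrant objects can be read
  off from their cofibrant twins.\<close>

definition opposite :: "('o, 'm) cat \<Rightarrow> ('o, 'm) cat" where
  "opposite C = \<lparr>Obj = Obj C, Hom = (\<lambda>x y. Hom C y x), Ident = Ident C,
     Comp = (\<lambda>g f. f \<cdot>\<^bsub>C\<^esub> g)\<rparr>"

lemma opposite_simps [simp]:
  "Obj (opposite C) = Obj C" "Hom (opposite C) x y = Hom C y x"
  "Ident (opposite C) = Ident C" "g \<cdot>\<^bsub>opposite C\<^esub> f = f \<cdot>\<^bsub>C\<^esub> g"
  by (auto simp: opposite_def)

lemma zero_object_opposite [simp]: "zero_object (opposite C) z = zero_object C z"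
  unfolding zero_object_def by auto

lemma Mor_opposite [simp]: "Mor (opposite C) = Mor C"
  unfolding Mor_def by auto

lemma (in category) category_opposite: "category (opposite C)"
  using hom_obj hom_disjoint ident_hom comp_hom comp_ident_left comp_ident_right comp_assoc
  by unfold_locales (auto; metis)+

section \<open>Matrix calculus for biproducts\<close>

lemma (in preadditive_category) biproduct_pair:
  assumes b: "biproduct C G x y b i j p q" and f: "f \<in> Hom C a x" and g: "g \<in> Hom C a y"
  shows "p \<cdot> ((i \<cdot> f) \<otimes>\<^bsub>G a b\<^esub> (j \<cdot> g)) = f" "q \<cdot> ((i \<cdot> f) \<otimes>\<^bsub>G a b\<^esub> (j \<cdot> g)) = g"
proof -
  have h: "i \<in> Hom C x b" "j \<in> Hom C y b" "p \<in> Hom C b x" "q \<in> Hom C b y"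
    and eq: "p \<cdot> i = Ident C x" "q \<cdot> j = Ident C y" "q \<cdot> i = \<one>\<^bsub>G x y\<^esub>" "p \<cdot> j = \<one>\<^bsub>G y x\<^esub>"
    using b unfolding biproduct_def by auto
  have o: "a \<in> Obj C" "x \<in> Obj C" "y \<in> Obj C"
    using f g hom_obj by auto
  interpret ax: comm_group "G a x" using hom_comm_group o by blast
  interpret ay: comm_group "G a y" using hom_comm_group o by blast
  have "p \<cdot> (i \<cdot> f) = f" "p \<cdot> (j \<cdot> g) = \<one>\<^bsub>G a x\<^esub>" "q \<cdot> (i \<cdot> f) = \<one>\<^bsub>G a y\<^esub>" "q \<cdot> (j \<cdot> g) = g"
    using comp_assoc[OF f h(1,3)] comp_assoc[OF g h(2,3)] comp_assoc[OF f h(1,4)]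
      comp_assoc[OF g h(2,4)] eq comp_ident_left[OF f] comp_ident_left[OF g]
      zero_comp[OF f o(3)] zero_comp[OF g o(2)] by simp_all
  then show "p \<cdot> ((i \<cdot> f) \<otimes>\<^bsub>G a b\<^esub> (j \<cdot> g)) = f" "q \<cdot> ((i \<cdot> f) \<otimes>\<^bsub>G a b\<^esub> (j \<cdot> g)) = g"
    using comp_add[OF comp_hom[OF f h(1)] comp_hom[OF g h(2)] h(3)]
      comp_add[OF comp_hom[OF f h(1)] comp_hom[OF g h(2)] h(4)] carrier_hom o f g by simp_all
qed

text \<open>Row \<open>(h, k)\<close> times column \<open>(f, g)\<close>; this is how a sum of two
  composites becomes a single composite through \<open>b\<close>.\<close>

lemma (in preadditive_category) biproduct_matrix:
  assumes b: "biproduct C G x y b i j p q"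
    and fg: "f \<in> Hom C a x" "g \<in> Hom C a y" and hk: "h \<in> Hom C x c" "k \<in> Hom C y c"
  shows "((h \<cdot> p) \<otimes>\<^bsub>G b c\<^esub> (k \<cdot> q)) \<cdot> ((i \<cdot> f) \<otimes>\<^bsub>G a b\<^esub> (j \<cdot> g)) = (h \<cdot> f) \<otimes>\<^bsub>G a c\<^esub> (k \<cdot> g)"
proof -
  have m: "i \<in> Hom C x b" "j \<in> Hom C y b" "p \<in> Hom C b x" "q \<in> Hom C b y"
    using b unfolding biproduct_def by auto
  note u = add_hom[OF comp_hom[OF fg(1) m(1)] comp_hom[OF fg(2) m(2)]]
  show ?thesis
    using add_comp[OF u comp_hom[OF m(3) hk(1)] comp_hom[OF m(4) hk(2)]] comp_assoc[OF u m(3) hk(1)]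
      comp_assoc[OF u m(4) hk(2)] biproduct_pair[OF b fg] by simp
qed

lemma (in preadditive_category) biproduct_components:
  assumes b: "biproduct C G x y b i j p q" and u: "u \<in> Hom C a b"
  shows "(i \<cdot> (p \<cdot> u)) \<otimes>\<^bsub>G a b\<^esub> (j \<cdot> (q \<cdot> u)) = u"
proof -
  have m: "i \<in> Hom C x b" "j \<in> Hom C y b" "p \<in> Hom C b x" "q \<in> Hom C b y"
    and "(i \<cdot> p) \<otimes>\<^bsub>G b b\<^esub> (j \<cdot> q) = Ident C b"
    using b unfolding biproduct_def by auto
  then show ?thesis
    using add_comp[OF u comp_hom[OF m(3,1)] comp_hom[OF m(4,2)]] comp_assoc[OF u m(3,1)]
      comp_assoc[OF u m(4,2)] comp_ident_left[OF u] by simp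
qed

lemma biproduct_opposite:
  "biproduct C G x y b i j p q \<Longrightarrow> biproduct (opposite C) (\<lambda>x y. G y x) x y b p q i j"
  unfolding biproduct_def by auto

lemma (in additive_category) additive_opposite: "additive_category (opposite C) (\<lambda>x y. G y x)"
proof -
  have "preadditive_category (opposite C) (\<lambda>x y. G y x)"
    by (rule preadditive_category.intro[OF category_opposite preadditive_category_axioms.intro])
      (use hom_comm_group carrier_hom comp_add_left comp_add_right in auto)
  then show ?thesis
  proof (rule additive_category.intro[OF _ additive_category_axioms.intro])
    fix x y assume "x \<in> Obj (opposite C)" "y \<in> Obj (opposite C)"
    then obtain b i j p q where "biproduct C G x y b i j p q"
      using ex_biproduct[of x y] by auto
    then have "biproduct (opposite C) (\<lambda>x y. G y x) x y b p q i j"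
      by (rule biproduct_opposite)
    then show "\<exists>b i j p q. biproduct (opposite C) (\<lambda>x y. G y x) x y b i j p q"
      by blast
  qed (use ex_zero_object in auto)
qed

section \<open>Additive structure on a full subcategory\<close>

lemma full_subcat_simps [simp]:
  "Obj (full_subcat C X) = X"
  "Ident (full_subcat C X) = Ident C"
  "Comp (full_subcat C X) = Comp C"
  "f \<in> Hom (full_subcat C X) x y \<longleftrightarrow> x \<in> X \<and> y \<in> X \<and> f \<in> Hom C x y"
  by (auto simp: full_subcat_def)

lemma (in additive_category) additive_full_subcat:
  assumes X: "X \<subseteq> Obj C" and zero: "\<exists>z\<in>X. zero_object C z"
    and biprod: "\<And>x y. x \<in> X \<Longrightarrow> y \<in> X \<Longrightarrow> \<exists>b\<in>X. \<exists>i j p q. biproduct C G x y b i j p q"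
  shows "additive_category (full_subcat C X) G"
proof -
  have obj: "x \<in> Obj C" if "x \<in> X" for x
    using that X by blast
  have hom: "Hom (full_subcat C X) x y = Hom C x y" if "x \<in> X" "y \<in> X" for x y
    using that by auto
  interpret sub: category "full_subcat C X"
  proof
    show "x = x' \<and> y = y'" if "f \<in> Hom (full_subcat C X) x y" "f \<in> Hom (full_subcat C X) x' y'"
      for f x y x' y'
      using that hom_disjoint[of f x y x' y'] by simp
    show "h \<cdot>\<^bsub>full_subcat C X\<^esub> g \<cdot>\<^bsub>full_subcat C X\<^esub> f = h \<cdot>\<^bsub>full_subcat C X\<^esub> (g \<cdot>\<^bsub>full_subcat C X\<^esub> f)"
      if "f \<in> Hom (full_subcat C X) w x" "g \<in> Hom (full_subcat C X) x y"
        "h \<in> Hom (full_subcat C X) y z" for f g h w x y z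
      using that comp_assoc[of f w x g y h z] by simp
  qed (use obj ident_hom comp_hom comp_ident_left comp_ident_right in auto)
  have "preadditive_category (full_subcat C X) G"
    by (rule preadditive_category.intro[OF sub.category_axioms preadditive_category_axioms.intro])
      (use obj hom hom_comm_group carrier_hom comp_add_left comp_add_right in auto)
  then show ?thesis
  proof (rule additive_category.intro[OF _ additive_category_axioms.intro])
    obtain z where z: "z \<in> X" "zero_object C z"
      using zero by blast
    then have "zero_object (full_subcat C X) z"
      using X unfolding zero_object_def by (auto simp: subset_iff)
    then show "\<exists>z. zero_object (full_subcat C X) z" by blast
    fix x y assume "x \<in> Obj (full_subcat C X)" "y \<in> Obj (full_subcat C X)"
    then show "\<exists>b i j p q. biproduct (full_subcat C X) G x y b i j p q"
      using biprod[of x y] unfolding biproduct_def by fastforce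
  qed
qed

section \<open>The quotient of an additive category by an additive subcategory\<close>

locale additive_subcategory = additive_category C G
  for C :: "('o, 'm) cat" (structure) and G :: "'o \<Rightarrow> 'o \<Rightarrow> 'm monoid" +
  fixes Y :: "'o set"
  assumes sub_obj: "Y \<subseteq> Obj C" and sub_nonempty: "Y \<noteq> {}"
    and sub_biproduct: "x \<in> Y \<Longrightarrow> y \<in> Y \<Longrightarrow> \<exists>b\<in>Y. \<exists>i j p q. biproduct C G x y b i j p q"
begin

abbreviation "N \<equiv> factoring_through C Y"

definition coset :: "'o \<Rightarrow> 'o \<Rightarrow> 'm \<Rightarrow> 'm set" where
  "coset x y f = N x y #>\<^bsub>G x y\<^esub> f"

abbreviation "Q \<equiv> additive_quotient C G Y"

lemma factoring_throughI:
  "z \<in> Y \<Longrightarrow> f \<in> Hom C x z \<Longrightarrow> g \<in> Hom C z y \<Longrightarrow> g \<cdot> f \<in> N x y"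
  unfolding factoring_through_def by blast

lemma factoring_through_hom: "n \<in> N x y \<Longrightarrow> n \<in> Hom C x y"
  unfolding factoring_through_def using comp_hom by blast

lemma comp_factoring_through:
  assumes "n \<in> N x y" "g \<in> Hom C y z"
  shows "g \<cdot> n \<in> N x z"
proof -
  obtain t h k where t: "t \<in> Y" "k \<in> Hom C x t" "h \<in> Hom C t y" "n = h \<cdot> k"
    using assms(1) unfolding factoring_through_def by blast
  then show ?thesis
    using factoring_throughI[OF t(1,2) comp_hom[OF t(3) assms(2)]] comp_assoc[OF t(2,3) assms(2)] by simp
qed

lemma factoring_through_comp:
  assumes "n \<in> N y z" "f \<in> Hom C x y"
  shows "n \<cdot> f \<in> N x z"
proof -
  obtain t h k where t: "t \<in> Y" "k \<in> Hom C y t" "h \<in> Hom C t z" "n = h \<cdot> k"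
    using assms(1) unfolding factoring_through_def by blast
  then show ?thesis
    using factoring_throughI[OF t(1) comp_hom[OF assms(2) t(2)] t(3)] comp_assoc[OF assms(2) t(2,3)] by simp
qed

lemma subgroup_factoring_through:
  assumes x: "x \<in> Obj C" and y: "y \<in> Obj C"
  shows "subgroup (N x y) (G x y)"
proof -
  interpret comm_group "G x y" using hom_comm_group x y .
  note carr = carrier_hom[OF x y]
  show ?thesis
  proof
    show "N x y \<subseteq> carrier (G x y)"
      using factoring_through_hom carr by blast
    \<comment> \<open>Any object of \<open>Y\<close> will do: the zero map factors through it as a
      composite of zero maps.\<close>
    obtain z where z: "z \<in> Y" "z \<in> Obj C"
      using sub_nonempty sub_obj by blast
    show "\<one>\<^bsub>G x y\<^esub> \<in> N x y"
      using factoring_throughI[OF z(1) zero_hom[OF x z(2)] zero_hom[OF z(2) y]]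
        comp_zero[OF zero_hom[OF z(2) y] x] by simp
  next
    fix n m assume "n \<in> N x y" "m \<in> N x y"
    then obtain s t f g h k where
      n: "s \<in> Y" "f \<in> Hom C x s" "g \<in> Hom C s y" "n = g \<cdot> f" and
      m: "t \<in> Y" "h \<in> Hom C x t" "k \<in> Hom C t y" "m = k \<cdot> h"
      unfolding factoring_through_def by blast
    obtain b i j p q where b: "b \<in> Y" "biproduct C G s t b i j p q"
      using sub_biproduct[OF n(1) m(1)] by blast
    then have ij: "i \<in> Hom C s b" "j \<in> Hom C t b" and pq: "p \<in> Hom C b s" "q \<in> Hom C b t"
      unfolding biproduct_def by auto
    \<comment> \<open>The two factorizations are merged through the biproduct of the middle objects
      \<open>s\<close> and \<open>t\<close>.\<close>
    have "n \<otimes>\<^bsub>G x y\<^esub> m =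
        ((g \<cdot> p) \<otimes>\<^bsub>G b y\<^esub> (k \<cdot> q)) \<cdot> ((i \<cdot> f) \<otimes>\<^bsub>G x b\<^esub> (j \<cdot> h))"
      using biproduct_matrix[OF b(2) n(2) m(2) n(3) m(3)] n(4) m(4) by simp
    then show "n \<otimes>\<^bsub>G x y\<^esub> m \<in> N x y"
      using factoring_throughI[OF b(1) add_hom[OF comp_hom[OF n(2) ij(1)] comp_hom[OF m(2) ij(2)]]
          add_hom[OF comp_hom[OF pq(1) n(3)] comp_hom[OF pq(2) m(3)]]] by simp
  next
    fix n assume "n \<in> N x y"
    then obtain s f g where n: "s \<in> Y" "f \<in> Hom C x s" "g \<in> Hom C s y" "n = g \<cdot> f"
      unfolding factoring_through_def by blast
    \<comment> \<open>\<open>-(g f) = g (-f)\<close> still factors through the same object.\<close>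
    have "inv\<^bsub>G x s\<^esub> f \<in> Hom C x s"
      using n sub_obj x carrier_hom[of x s] hom_comm_group[of x s] comm_group.axioms(2) group.inv_closed
      by (metis subsetD)
    then show "inv\<^bsub>G x y\<^esub> n \<in> N x y"
      using factoring_throughI[OF n(1) _ n(3)] comp_inv[OF n(2,3)] n(4) by metis
  qed
qed

lemma mem_coset_iff:
  "f \<in> coset x y g \<longleftrightarrow> (\<exists>n\<in>N x y. f = n \<otimes>\<^bsub>G x y\<^esub> g)"
  unfolding coset_def r_coset_def by auto

lemma coset_subset: "g \<in> Hom C x y \<Longrightarrow> coset x y g \<subseteq> Hom C x y"
  using factoring_through_hom add_hom by (auto simp: mem_coset_iff)

lemma mem_coset_self: "f \<in> Hom C x y \<Longrightarrow> f \<in> coset x y f"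
  unfolding coset_def
  using group.rcos_self comm_group.axioms(2) hom_comm_group carrier_hom hom_obj
    subgroup_factoring_through by metis

lemma coset_eqI:
  assumes "f \<in> coset x y g" "g \<in> Hom C x y"
  shows "coset x y f = coset x y g"
  using assms unfolding coset_def
  using group.repr_independence comm_group.axioms(2) hom_comm_group carrier_hom hom_obj
    subgroup_factoring_through by metis

text \<open>The morphisms through \<open>Y\<close> form a two-sided ideal, so the representatives
  can be replaced one at a time: first \<open>f'\<close> by \<open>f\<close>, then \<open>g'\<close>
  by \<open>g\<close>.\<close>

lemma coset_comp:
  assumes f: "f \<in> Hom C x y" "f' \<in> coset x y f" and g: "g \<in> Hom C y z" "g' \<in> coset y z g"
  shows "coset x z (g' \<cdot> f') = coset x z (g \<cdot> f)"
proof -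
  obtain n m where n: "n \<in> N x y" "f' = n \<otimes>\<^bsub>G x y\<^esub> f" and m: "m \<in> N y z" "g' = m \<otimes>\<^bsub>G y z\<^esub> g"
    using f g mem_coset_iff by auto
  note h = factoring_through_hom[OF n(1)] factoring_through_hom[OF m(1)]
  have g': "g' \<in> Hom C y z"
    using m h g add_hom by simp
  have "g' \<cdot> f' = (g' \<cdot> n) \<otimes>\<^bsub>G x z\<^esub> (g' \<cdot> f)"
    using comp_add[OF h(1) f(1) g'] n by simp
  then have "coset x z (g' \<cdot> f') = coset x z (g' \<cdot> f)"
    using coset_eqI comp_hom[OF f(1) g'] comp_factoring_through[OF n(1) g'] mem_coset_iff by blast
  moreover have "g' \<cdot> f = (m \<cdot> f) \<otimes>\<^bsub>G x z\<^esub> (g \<cdot> f)"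
    using add_comp[OF f(1) h(2) g(1)] m by simp
  then have "coset x z (g' \<cdot> f) = coset x z (g \<cdot> f)"
    using coset_eqI comp_hom[OF f(1) g(1)] factoring_through_comp[OF m(1) f(1)] mem_coset_iff by blast
  ultimately show ?thesis by simp
qed

lemma Obj_quotient [simp]: "Obj Q = Obj C"
  by (simp add: additive_quotient_def)

lemma carrier_quotient:
  "x \<in> Obj C \<Longrightarrow> y \<in> Obj C \<Longrightarrow> carrier (quotient_hom_group C G Y x y) = coset x y ` Hom C x y"
  by (simp add: quotient_hom_group_def carrier_FactGroup carrier_hom coset_def)

lemma Hom_quotient: "Hom Q x y = coset x y ` Hom C x y"
proof (cases "x \<in> Obj C \<and> y \<in> Obj C")
  case True
  then show ?thesis
    by (simp add: additive_quotient_def carrier_quotient)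
next
  case False
  then have "Hom C x y = {}"
    using hom_obj by blast
  then show ?thesis
    using False by (auto simp: additive_quotient_def)
qed

lemma coset_hom: "f \<in> Hom C x y \<Longrightarrow> coset x y f \<in> Hom Q x y"
  by (simp add: Hom_quotient)

lemma Ident_quotient: "Ident Q x = coset x x (Ident C x)"
  by (simp add: additive_quotient_def coset_def)

text \<open>\<open>Comp\<close> of the quotient joins cosets over all endpoints and representatives.
  Representatives have unique endpoints and their composites share one coset, so the union is over a
  single set.\<close>

lemma comp_quotient:
  assumes f: "f \<in> Hom C x y" and g: "g \<in> Hom C y z"
  shows "coset y z g \<cdot>\<^bsub>Q\<^esub> coset x y f = coset x z (g \<cdot> f)"
proof -
  have "{coset a c (v \<cdot> u) | u v a b c. u \<in> coset x y f \<inter> Hom C a b \<and> v \<in> coset y z g \<inter> Hom C b c}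
    = {coset x z (g \<cdot> f)}" (is "?L = _")
  proof (intro subset_antisym subsetI)
    fix U assume "U \<in> ?L"
    then obtain u v a b c where u: "u \<in> coset x y f" "u \<in> Hom C a b" and v: "v \<in> coset y z g" "v \<in> Hom C b c"
      and U: "U = coset a c (v \<cdot> u)"
      by blast
    have "a = x" "c = z"
      using coset_subset f g u v hom_disjoint by blast+
    then show "U \<in> {coset x z (g \<cdot> f)}"
      using U coset_comp[OF f u(1) g v(1)] by simp
  qed (use mem_coset_self[OF f] mem_coset_self[OF g] f g in blast)
  then show ?thesis
    by (simp add: additive_quotient_def coset_def)
qed

lemma add_quotient:
  assumes "f \<in> Hom C x y" "g \<in> Hom C x y"
  shows "coset x y f \<otimes>\<^bsub>quotient_hom_group C G Y x y\<^esub> coset x y g = coset x y (f \<otimes>\<^bsub>G x y\<^esub> g)"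
proof -
  have o: "x \<in> Obj C" "y \<in> Obj C"
    using assms hom_obj by auto
  interpret comm_group "G x y" using hom_comm_group o .
  show ?thesis
    using normal.rcos_sum[of "N x y" "G x y" f g] subgroup_factoring_through[OF o] assms carrier_hom[OF o]
    by (simp add: quotient_hom_group_def coset_def normal_iff_subgroup)
qed

lemma zero_quotient:
  assumes o: "x \<in> Obj C" "y \<in> Obj C"
  shows "\<one>\<^bsub>quotient_hom_group C G Y x y\<^esub> = coset x y \<one>\<^bsub>G x y\<^esub>"
proof -
  interpret comm_group "G x y" using hom_comm_group o .
  show ?thesis
    using subgroup.subset[OF subgroup_factoring_through[OF o]]
    by (simp add: quotient_hom_group_def coset_def)
qed

lemma category_quotient: "category Q"
proof
  show "x = x' \<and> y = y'" if "U \<in> Hom Q x y" "U \<in> Hom Q x' y'" for U x y x' y'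
  proof -
    obtain f f' where "f \<in> Hom C x y" "f' \<in> Hom C x' y'" "U = coset x y f" "U = coset x' y' f'"
      using \<open>U \<in> Hom Q x y\<close> \<open>U \<in> Hom Q x' y'\<close> by (auto simp: Hom_quotient)
    then show ?thesis
      using mem_coset_self coset_subset hom_disjoint by blast
  qed
  show "W \<cdot>\<^bsub>Q\<^esub> V \<cdot>\<^bsub>Q\<^esub> U = W \<cdot>\<^bsub>Q\<^esub> (V \<cdot>\<^bsub>Q\<^esub> U)" if "U \<in> Hom Q w x" "V \<in> Hom Q x y" "W \<in> Hom Q y z"
    for U V W w x y z
    using that comp_assoc by (auto simp: Hom_quotient comp_quotient comp_hom)
qed (auto simp: Hom_quotient Ident_quotient comp_quotient ident_hom hom_obj comp_hom
    comp_ident_left comp_ident_right)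

text \<open>Taking cosets respects identities, composition, sums and zeros, so equations descend
  from \<open>C\<close>; in particular biproducts go to biproducts, and one-element hom-sets stay
  so.\<close>

lemma additive_quotient_additive: "additive_category Q (quotient_hom_group C G Y)"
proof (rule additive_category.intro)
  interpret Q: category Q by (rule category_quotient)
  show "preadditive_category Q (quotient_hom_group C G Y)"
  proof (rule preadditive_category.intro[OF Q.category_axioms preadditive_category_axioms.intro])
    fix x y assume o: "x \<in> Obj Q" "y \<in> Obj Q"
    then show "comm_group (quotient_hom_group C G Y x y)"
      using comm_group.abelian_FactGroup[OF hom_comm_group subgroup_factoring_through]
      by (simp add: quotient_hom_group_def)
    show "carrier (quotient_hom_group C G Y x y) = Hom Q x y"
      using o by (simp add: Hom_quotient carrier_quotient)
  next
    fix V x y z assume V: "V \<in> Hom Q y z" and x: "x \<in> Obj Q"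
    then obtain g where g: "g \<in> Hom C y z" "V = coset y z g"
      by (auto simp: Hom_quotient)
    then have yz: "y \<in> Obj C" "z \<in> Obj C" using hom_obj by auto
    show "(\<lambda>U. V \<cdot>\<^bsub>Q\<^esub> U) \<in> hom (quotient_hom_group C G Y x y) (quotient_hom_group C G Y x z)"
      by (rule homI)
        (use x yz g in \<open>auto simp: carrier_quotient comp_quotient add_quotient add_hom comp_hom comp_add\<close>)
  next
    fix U x y z assume U: "U \<in> Hom Q x y" and z: "z \<in> Obj Q"
    then obtain f where f: "f \<in> Hom C x y" "U = coset x y f"
      by (auto simp: Hom_quotient)
    then have xy: "x \<in> Obj C" "y \<in> Obj C" using hom_obj by auto
    show "(\<lambda>V. V \<cdot>\<^bsub>Q\<^esub> U) \<in> hom (quotient_hom_group C G Y y z) (quotient_hom_group C G Y x z)"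
      by (rule homI)
        (use z xy f in \<open>auto simp: carrier_quotient comp_quotient add_quotient add_hom comp_hom add_comp\<close>)
  qed
  show "additive_category_axioms Q (quotient_hom_group C G Y)"
  proof
    obtain z where z: "zero_object C z"
      using ex_zero_object by blast
    have "zero_object Q z"
      unfolding zero_object_def
    proof (intro conjI ballI)
      show "z \<in> Obj Q" using z by (simp add: zero_object_def)
      fix x assume "x \<in> Obj Q"
      then have "\<exists>!f. f \<in> Hom C z x" "\<exists>!f. f \<in> Hom C x z"
        using z by (auto simp: zero_object_def)
      then show "\<exists>!f. f \<in> Hom Q z x" "\<exists>!f. f \<in> Hom Q x z"
        by (auto simp: Hom_quotient)
    qed
    then show "\<exists>z. zero_object Q z" by blast
    fix x y assume "x \<in> Obj Q" "y \<in> Obj Q"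
    then have o: "x \<in> Obj C" "y \<in> Obj C" by auto
    obtain b i j p q where b: "biproduct C G x y b i j p q"
      using ex_biproduct[OF o] by blast
    then have h: "i \<in> Hom C x b" "j \<in> Hom C y b" "p \<in> Hom C b x" "q \<in> Hom C b y"
      unfolding biproduct_def by auto
    have "biproduct Q (quotient_hom_group C G Y) x y b (coset x b i) (coset y b j) (coset b x p) (coset b y q)"
      using b h o unfolding biproduct_def
      by (simp add: coset_hom comp_quotient zero_quotient Ident_quotient
          add_quotient[OF comp_hom[OF h(3,1)] comp_hom[OF h(4,2)]])
    then show "\<exists>b i j p q. biproduct Q (quotient_hom_group C G Y) x y b i j p q" by blast
  qed
qed

end

section \<open>Duality for model structures\<close>

lemma retract_of_opposite: "retract_of (opposite C) f g \<Longrightarrow> retract_of C f g"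
  unfolding retract_of_def
proof (elim exE)
  fix a b c d i r j s
  assume "f \<in> Hom (opposite C) a b \<and> g \<in> Hom (opposite C) c d \<and> i \<in> Hom (opposite C) a c \<and>
    r \<in> Hom (opposite C) c a \<and> r \<cdot>\<^bsub>opposite C\<^esub> i = Ident (opposite C) a \<and>
    j \<in> Hom (opposite C) b d \<and> s \<in> Hom (opposite C) d b \<and>
    s \<cdot>\<^bsub>opposite C\<^esub> j = Ident (opposite C) b \<and> g \<cdot>\<^bsub>opposite C\<^esub> i = j \<cdot>\<^bsub>opposite C\<^esub> f \<and>
    f \<cdot>\<^bsub>opposite C\<^esub> r = s \<cdot>\<^bsub>opposite C\<^esub> g"
  then show "\<exists>a b c d i r j s. f \<in> Hom C a b \<and> g \<in> Hom C c d \<and> i \<in> Hom C a c \<and> r \<in> Hom C c a \<and>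
    r \<cdot>\<^bsub>C\<^esub> i = Ident C a \<and> j \<in> Hom C b d \<and> s \<in> Hom C d b \<and> s \<cdot>\<^bsub>C\<^esub> j = Ident C b \<and>
    g \<cdot>\<^bsub>C\<^esub> i = j \<cdot>\<^bsub>C\<^esub> f \<and> f \<cdot>\<^bsub>C\<^esub> r = s \<cdot>\<^bsub>C\<^esub> g"
    \<comment> \<open>Reversing arrows swaps source and target of \<open>f\<close> and of
      \<open>g\<close>, and turns each section into a retraction at the same object; hence the order
      \<open>s\<close>, \<open>j\<close>, \<open>r\<close>, \<open>i\<close>.\<close>
    by - (rule exI[of _ b], rule exI[of _ a], rule exI[of _ d], rule exI[of _ c], rule exI[of _ s],
        rule exI[of _ j], rule exI[of _ r], rule exI[of _ i], simp)
qed

lemma lifts_against_opposite: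
  assumes "lifts_against C p i"
  shows "lifts_against (opposite C) i p"
  unfolding lifts_against_def
proof (intro allI impI)
  fix a b x y u v
  assume "i \<in> Hom (opposite C) a b" "p \<in> Hom (opposite C) x y" "u \<in> Hom (opposite C) a x"
    "v \<in> Hom (opposite C) b y" "p \<cdot>\<^bsub>opposite C\<^esub> u = v \<cdot>\<^bsub>opposite C\<^esub> i"
  then have "p \<in> Hom C y x" "i \<in> Hom C b a" "v \<in> Hom C y b" "u \<in> Hom C x a" "i \<cdot>\<^bsub>C\<^esub> v = u \<cdot>\<^bsub>C\<^esub> p"
    by simp_all
  then have "\<exists>h\<in>Hom C x b. h \<cdot>\<^bsub>C\<^esub> p = v \<and> i \<cdot>\<^bsub>C\<^esub> h = u"
    using assms unfolding lifts_against_def by (metis (no_types))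
  then show "\<exists>h\<in>Hom (opposite C) b x. h \<cdot>\<^bsub>opposite C\<^esub> i = u \<and> p \<cdot>\<^bsub>opposite C\<^esub> h = v"
    by auto
qed

text \<open>The axioms are self-dual as a whole: the two liftings, the two factorizations and the
  last two clauses of two-out-of-three change places.\<close>

lemma (in model_structure) model_structure_opposite: "model_structure (opposite C) Fib Cofib Weq"
proof -
  interpret op: category "opposite C" by (rule category_opposite)
  show ?thesis
  proof (rule model_structure.intro[OF op.category_axioms model_structure_axioms.intro])
    show "lifts_against (opposite C) i p" if "i \<in> Fib" "p \<in> Cofib \<inter> Weq" for i p
      by (rule lifts_against_opposite[OF lifting(2)[OF that(2,1)]])
    show "lifts_against (opposite C) i p" if "i \<in> Fib \<inter> Weq" "p \<in> Cofib" for i p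
      by (rule lifts_against_opposite[OF lifting(1)[OF that(2,1)]])
    fix f x y assume "f \<in> Hom (opposite C) x y"
    then have f: "f \<in> Hom C y x" by simp
    show "\<exists>z i p. i \<in> Hom (opposite C) x z \<and> p \<in> Hom (opposite C) z y \<and>
        p \<cdot>\<^bsub>opposite C\<^esub> i = f \<and> i \<in> Fib \<and> p \<in> Cofib \<inter> Weq"
      using factorization(2)[OF f] by auto
    show "\<exists>z i p. i \<in> Hom (opposite C) x z \<and> p \<in> Hom (opposite C) z y \<and>
        p \<cdot>\<^bsub>opposite C\<^esub> i = f \<and> i \<in> Fib \<inter> Weq \<and> p \<in> Cofib"
      using factorization(1)[OF f] by auto
    show "g \<cdot>\<^bsub>opposite C\<^esub> f \<in> Weq"
      if "f \<in> Hom (opposite C) x y" "g \<in> Hom (opposite C) y z" "f \<in> Weq" "g \<in> Weq" for f g x y z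
      using that two_of_three(1)[of g z y f x] by simp
    show "g \<in> Weq"
      if "f \<in> Hom (opposite C) x y" "g \<in> Hom (opposite C) y z" "f \<in> Weq" "g \<cdot>\<^bsub>opposite C\<^esub> f \<in> Weq"
      for f g x y z
      using that two_of_three(3)[of g z y f x] by simp
    show "f \<in> Weq"
      if "f \<in> Hom (opposite C) x y" "g \<in> Hom (opposite C) y z" "g \<in> Weq" "g \<cdot>\<^bsub>opposite C\<^esub> f \<in> Weq"
      for f g x y z
      using that two_of_three(2)[of g z y f x] by simp
  qed (use classes in \<open>auto dest!: retract_of_opposite dest: retracts\<close>)
qed

section \<open>Naturality on a localization\<close>

lemma (in category) square_comp:
  assumes h: "a \<in> Hom C x x'" "b \<in> Hom C y y'" "c \<in> Hom C z z'"
    "f \<in> Hom C x y" "g \<in> Hom C y z" "f' \<in> Hom C x' y'" "g' \<in> Hom C y' z'"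
    and "f' \<cdot> a = b \<cdot> f" "g' \<cdot> b = c \<cdot> g"
  shows "(g' \<cdot> f') \<cdot> a = c \<cdot> (g \<cdot> f)"
  using comp_assoc[OF h(1,6,7)] comp_assoc[OF h(4,2,7)] comp_assoc[OF h(4,5,3)] assms(8,9) by simp

lemma (in category) square_inverse:
  assumes a: "a \<in> Hom C x x'" and b: "b \<in> Hom C y y'"
    and f: "inverse_morphisms C x y f g" and f': "inverse_morphisms C x' y' f' g'"
    and sq: "f' \<cdot> a = b \<cdot> f"
  shows "g' \<cdot> b = a \<cdot> g"
proof -
  have h: "f \<in> Hom C x y" "g \<in> Hom C y x" "f' \<in> Hom C x' y'" "g' \<in> Hom C y' x'"
    "f \<cdot> g = Ident C y" "g' \<cdot> f' = Ident C x'"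
    using f f' unfolding inverse_morphisms_def by auto
  have "g' \<cdot> b = g' \<cdot> ((b \<cdot> f) \<cdot> g)"
    using comp_assoc[OF h(2,1) b] comp_ident_right[OF b] h(5) by simp
  also have "\<dots> = (g' \<cdot> (f' \<cdot> a)) \<cdot> g"
    using comp_assoc[OF h(2) comp_hom[OF h(1) b] h(4)] sq by simp
  also have "\<dots> = a \<cdot> g"
    using comp_assoc[OF a h(3,4)] h(6) comp_ident_left[OF a] by simp
  finally show ?thesis .
qed

lemma (in cat_functor) map_inverse_morphisms:
  "inverse_morphisms C x y f g \<Longrightarrow> inverse_morphisms D (Fo x) (Fo y) (Fm f) (Fm g)"
  using source.hom_obj unfolding inverse_morphisms_def by (metis hom_map map_comp map_ident)

text \<open>Zigzags are composed of images of morphisms of \<open>C\<close> and of inverses of such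
  images. A naturality square on an invertible map yields one on its inverse by
  \<open>square_inverse\<close>, and squares are pasted by \<open>square_comp\<close>.\<close>

lemma natural_on_localization:
  assumes C: "category C"
    and F: "cat_functor (localization C W) D Fo Fm" and K: "cat_functor (localization C W) D Ko Km"
    and \<eta>: "\<And>x. x \<in> Obj C \<Longrightarrow> \<eta> x \<in> Hom D (Fo x) (Ko x)"
    and nat: "\<And>f x y. f \<in> Hom C x y \<Longrightarrow>
      Km (localize C W f) \<cdot>\<^bsub>D\<^esub> \<eta> x = \<eta> y \<cdot>\<^bsub>D\<^esub> Fm (localize C W f)"
    and X: "X \<in> Hom (localization C W) x y"
  shows "Km X \<cdot>\<^bsub>D\<^esub> \<eta> x = \<eta> y \<cdot>\<^bsub>D\<^esub> Fm X"
proof -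
  interpret C: category C by fact
  interpret F: cat_functor "localization C W" D Fo Fm by fact
  interpret K: cat_functor "localization C W" D Ko Km by fact
  have cls: "zigzag_class C W x y p \<in> Hom (localization C W) x y" if "zigzag C W x y p" for x y p
    using that by (auto simp: localization_def)
  have step: "Km (zigzag_class C W x z (s # p)) \<cdot>\<^bsub>D\<^esub> \<eta> x = \<eta> z \<cdot>\<^bsub>D\<^esub> Fm (zigzag_class C W x z (s # p))"
    if s: "zigzag C W x y [s]" and p: "zigzag C W y z p"
      and 1: "Km (zigzag_class C W x y [s]) \<cdot>\<^bsub>D\<^esub> \<eta> x = \<eta> y \<cdot>\<^bsub>D\<^esub> Fm (zigzag_class C W x y [s])"
      and 2: "Km (zigzag_class C W y z p) \<cdot>\<^bsub>D\<^esub> \<eta> y = \<eta> z \<cdot>\<^bsub>D\<^esub> Fm (zigzag_class C W y z p)"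
    for x y z s p
  proof -
    have split: "zigzag_class C W x z (s # p) =
        zigzag_class C W y z p \<cdot>\<^bsub>localization C W\<^esub> zigzag_class C W x y [s]"
      using comp_zigzag_class[OF s p] by simp
    have o: "x \<in> Obj C" "y \<in> Obj C" "z \<in> Obj C"
      using zigzag_objects[OF C s] zigzag_objects[OF C p] by auto
    show ?thesis
      unfolding split F.map_comp[OF cls[OF s] cls[OF p]] K.map_comp[OF cls[OF s] cls[OF p]]
      using F.target.square_comp[OF \<eta>[OF o(1)] \<eta>[OF o(2)] \<eta>[OF o(3)] F.hom_map[OF cls[OF s]] F.hom_map[OF cls[OF p]]
          K.hom_map[OF cls[OF s]] K.hom_map[OF cls[OF p]] 1 2] .
  qed
  have "Km (zigzag_class C W x y p) \<cdot>\<^bsub>D\<^esub> \<eta> x = \<eta> y \<cdot>\<^bsub>D\<^esub> Fm (zigzag_class C W x y p)"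
    if "zigzag C W x y p" for x y p
    using that
  proof induction
    case (zigzag_Nil x)
    then show ?case
      using F.map_ident[of x] K.map_ident[of x] F.target.comp_ident_left[OF \<eta>]
        F.target.comp_ident_right[OF \<eta>] by (simp add: localization_def)
  next
    case (zigzag_Fwd f x y z p)
    then have "zigzag C W x y [Fwd f]"
      using C.hom_obj[of f x y] by (auto intro!: zigzag.intros)
    then show ?case
      using step[OF _ zigzag_Fwd(2) nat[OF zigzag_Fwd(1), unfolded localize_eq[OF C zigzag_Fwd(1)]]
          zigzag_Fwd.IH] by blast
  next
    case (zigzag_Bwd w y x z p)
    then have o: "x \<in> Obj C" "y \<in> Obj C"
      using C.hom_obj[of w y x] by auto
    note inv = localize_inverts[OF C zigzag_Bwd(1,2)]
    have "Km (zigzag_class C W x y [Bwd w]) \<cdot>\<^bsub>D\<^esub> \<eta> x = \<eta> y \<cdot>\<^bsub>D\<^esub> Fm (zigzag_class C W x y [Bwd w])"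
      using F.target.square_inverse[OF \<eta>[OF o(2)] \<eta>[OF o(1)] F.map_inverse_morphisms[OF inv]
          K.map_inverse_morphisms[OF inv] nat[OF zigzag_Bwd(2)]] .
    moreover have "zigzag C W x y [Bwd w]"
      using zigzag_Bwd(1,2) o by (auto intro!: zigzag.intros)
    ultimately show ?case
      using step[OF _ zigzag_Bwd(3) _ zigzag_Bwd.IH] by blast
  qed
  then show ?thesis
    using X by (auto simp: localization_def)
qed

section \<open>Model structures on additive categories\<close>

lemma zero_object_unique:
  assumes "zero_object C z" "x \<in> Obj C"
  shows "f \<in> Hom C z x \<Longrightarrow> g \<in> Hom C z x \<Longrightarrow> f = g" "f \<in> Hom C x z \<Longrightarrow> g \<in> Hom C x z \<Longrightarrow> f = g"
    "\<exists>f. f \<in> Hom C z x" "\<exists>f. f \<in> Hom C x z"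
  using assms unfolding zero_object_def by blast+

text \<open>The square with \<open>j\<close> on top and the identity of \<open>b\<close> below has a
  diagonal. It is a section of \<open>p\<close>, and it exhibits the composite as a retract of
  \<open>j\<close> with the source \<open>a\<close> kept fixed.\<close>

lemma (in category) retract_argument:
  assumes j: "j \<in> Hom C a z" and p: "p \<in> Hom C z b" and "lifts_against C (p \<cdot> j) p"
  shows "retract_of C (p \<cdot> j) j"
proof -
  have a: "a \<in> Obj C" "b \<in> Obj C"
    using j p hom_obj by auto
  have "p \<cdot> j = Ident C b \<cdot> (p \<cdot> j)"
    using comp_ident_left[OF comp_hom[OF j p]] by simp
  then obtain h where h: "h \<in> Hom C b z" "h \<cdot> (p \<cdot> j) = j" "p \<cdot> h = Ident C b"
    using assms(3) j p comp_hom[OF j p] ident_hom[OF a(2)] unfolding lifts_against_def by meson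
  show ?thesis
    unfolding retract_of_def
    by (rule exI[of _ a], rule exI[of _ b], rule exI[of _ a], rule exI[of _ z],
        rule exI[of _ "Ident C a"], rule exI[of _ "Ident C a"], rule exI[of _ h], rule exI[of _ p])
      (use h j p a ident_hom comp_hom comp_ident_left[OF ident_hom] comp_ident_right
        comp_ident_right[OF comp_hom[OF j p]] in auto)
qed

context model_structure
begin

text \<open>Factor \<open>i\<close> so that the second factor is among the maps it lifts against;
  the retract argument hands the class of the first factor on to \<open>i\<close>.\<close>

lemma cofibI:
  assumes i: "i \<in> Hom C a b" and lift: "\<And>p. p \<in> Fib \<inter> Weq \<Longrightarrow> lifts_against C i p"
  shows "i \<in> Cofib"
proof -
  obtain z j p where "j \<in> Hom C a z" "p \<in> Hom C z b" "p \<cdot> j = i" "j \<in> Cofib" "p \<in> Fib \<inter> Weq"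
    using factorization(1)[OF i] by blast
  then show ?thesis
    using retract_argument lift retracts(1) by metis
qed

lemma trivial_cofibI:
  assumes i: "i \<in> Hom C a b" and lift: "\<And>p. p \<in> Fib \<Longrightarrow> lifts_against C i p"
  shows "i \<in> Cofib \<inter> Weq"
proof -
  obtain z j p where "j \<in> Hom C a z" "p \<in> Hom C z b" "p \<cdot> j = i" "j \<in> Cofib \<inter> Weq" "p \<in> Fib"
    using factorization(2)[OF i] by blast
  then show ?thesis
    using retract_argument lift retracts(1,3) by (metis IntD1 IntD2 IntI)
qed

text \<open>The axioms do not place identities in any class by themselves, but an identity lifts
  against everything: the top edge \<open>u\<close> is the diagonal.\<close>

lemma ident_trivial_cofib: "x \<in> Obj C \<Longrightarrow> Ident C x \<in> Cofib \<inter> Weq"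
proof (rule trivial_cofibI)
  fix p assume x: "x \<in> Obj C"
  show "lifts_against C (Ident C x) p"
    unfolding lifts_against_def
  proof (intro allI impI)
    fix a b e c u v
    assume h: "Ident C x \<in> Hom C a b" "p \<in> Hom C e c" "u \<in> Hom C a e" "v \<in> Hom C b c"
      "p \<cdot> u = v \<cdot> Ident C x"
    then have "a = x" "b = x"
      using hom_disjoint[OF ident_hom[OF x]] by auto
    then show "\<exists>h\<in>Hom C b e. h \<cdot> Ident C x = u \<and> p \<cdot> h = v"
      using h comp_ident_right by (intro bexI[of _ u]) auto
  qed
qed (rule ident_hom)

lemma ident_fib: "x \<in> Obj C \<Longrightarrow> Ident C x \<in> Fib"
  using model_structure.ident_trivial_cofib[OF model_structure_opposite, of x] by simp

end

text \<open>The lifting property of \<open>0 \<rightarrow> x\<close> with the part forced by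
  initiality removed: no zero object is chosen and only the lower triangle remains. Taken in the
  opposite category it says injective relative to \<open>S\<close>.\<close>

definition projective :: "('o, 'm) cat \<Rightarrow> 'm set \<Rightarrow> 'o \<Rightarrow> bool" where
  "projective C S x \<longleftrightarrow> x \<in> Obj C \<and>
     (\<forall>p e b v. p \<in> S \<longrightarrow> p \<in> Hom C e b \<longrightarrow> v \<in> Hom C x b \<longrightarrow> (\<exists>h\<in>Hom C x e. p \<cdot>\<^bsub>C\<^esub> h = v))"

lemma projectiveD:
  assumes "projective C S x" "p \<in> S" "p \<in> Hom C e b" "v \<in> Hom C x b"
  obtains h where "h \<in> Hom C x e" "p \<cdot>\<^bsub>C\<^esub> h = v"
  using assms unfolding projective_def by blast

text \<open>Maps out of \<open>z\<close> are unique, so every square on \<open>f\<close> commutes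
  and the upper triangle of a lift is automatic.\<close>

lemma (in category) projective_iff_lifts:
  assumes z: "zero_object C z" and f: "f \<in> Hom C z x" and S: "S \<subseteq> Mor C"
  shows "projective C S x \<longleftrightarrow> (\<forall>p\<in>S. lifts_against C f p)"
proof (intro iffI ballI)
  fix p assume P: "projective C S x" and p: "p \<in> S"
  show "lifts_against C f p"
    unfolding lifts_against_def
  proof (intro allI impI)
    fix a b e c u v
    assume h: "f \<in> Hom C a b" "p \<in> Hom C e c" "u \<in> Hom C a e" "v \<in> Hom C b c"
    then have ab: "a = z" "b = x"
      using hom_disjoint f by auto
    then obtain k where k: "k \<in> Hom C x e" "p \<cdot> k = v"
      using projectiveD[OF P p h(2)] h by blast
    moreover have "k \<cdot> f = u"
      using zero_object_unique(1)[OF z _ comp_hom[OF f k(1)]] h ab hom_obj by blast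
    ultimately show "\<exists>h\<in>Hom C b e. h \<cdot> f = u \<and> p \<cdot> h = v"
      using ab by blast
  qed
next
  assume l: "\<forall>p\<in>S. lifts_against C f p"
  show "projective C S x"
    unfolding projective_def
  proof (intro conjI allI impI)
    show "x \<in> Obj C" using f hom_obj by blast
    fix p e b v assume p: "p \<in> S" "p \<in> Hom C e b" and v: "v \<in> Hom C x b"
    have o: "e \<in> Obj C" "b \<in> Obj C"
      using p hom_obj by auto
    obtain u where u: "u \<in> Hom C z e"
      using zero_object_unique(3)[OF z o(1)] by blast
    have "p \<cdot> u = v \<cdot> f"
      using zero_object_unique(1)[OF z o(2) comp_hom[OF u p(2)] comp_hom[OF f v]] .
    then show "\<exists>h\<in>Hom C x e. p \<cdot> h = v"
      using l p u v f unfolding lifts_against_def by meson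
  qed
qed

text \<open>Lift on each summand and glue to \<open>h p + k q\<close>; composed with
  \<open>s\<close> this becomes \<open>v (i p + j q) = v\<close>.\<close>

lemma (in preadditive_category) projective_biproduct:
  assumes x: "projective C S x" and y: "projective C S y" and b: "biproduct C G x y b i j p q"
  shows "projective C S b"
  unfolding projective_def
proof (intro conjI allI impI)
  have m: "i \<in> Hom C x b" "j \<in> Hom C y b" "p \<in> Hom C b x" "q \<in> Hom C b y"
    using b unfolding biproduct_def by auto
  then show "b \<in> Obj C" using hom_obj by blast
  fix s e c v assume s: "s \<in> S" "s \<in> Hom C e c" and v: "v \<in> Hom C b c"
  obtain h where h: "h \<in> Hom C x e" "s \<cdot> h = v \<cdot> i"
    using projectiveD[OF x s comp_hom[OF m(1) v]] .
  obtain k where k: "k \<in> Hom C y e" "s \<cdot> k = v \<cdot> j"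
    using projectiveD[OF y s comp_hom[OF m(2) v]] .
  have "s \<cdot> ((h \<cdot> p) \<otimes>\<^bsub>G b e\<^esub> (k \<cdot> q)) = ((v \<cdot> i) \<cdot> p) \<otimes>\<^bsub>G b c\<^esub> ((v \<cdot> j) \<cdot> q)"
    using comp_add[OF comp_hom[OF m(3) h(1)] comp_hom[OF m(4) k(1)] s(2)]
      comp_assoc[OF m(3) h(1) s(2)] comp_assoc[OF m(4) k(1) s(2)] h(2) k(2) by simp
  also have "\<dots> = v \<cdot> ((i \<cdot> p) \<otimes>\<^bsub>G b b\<^esub> (j \<cdot> q))"
    using comp_add[OF comp_hom[OF m(3,1)] comp_hom[OF m(4,2)] v]
      comp_assoc[OF m(3,1) v] comp_assoc[OF m(4,2) v] by simp
  also have "\<dots> = v"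
    using b comp_ident_right[OF v] unfolding biproduct_def by simp
  finally show "\<exists>h\<in>Hom C b e. s \<cdot> h = v"
    using add_hom[OF comp_hom[OF m(3) h(1)] comp_hom[OF m(4) k(1)]] by blast
qed

section \<open>Cofibrant, fibrant and trivial objects through lifting\<close>

locale additive_model_category = additive_category C G + model_structure C Cofib Fib Weq
  for C :: "('o, 'm) cat" (structure) and G :: "'o \<Rightarrow> 'o \<Rightarrow> 'm monoid" and Cofib Fib Weq :: "'m set"
begin

abbreviation "CC \<equiv> cofibrant_objects C Cofib"
abbreviation "FF \<equiv> fibrant_objects C Fib"
abbreviation "WW \<equiv> trivial_objects C Weq"
abbreviation "B \<equiv> CC \<inter> FF"
abbreviation "T \<equiv> CC \<inter> FF \<inter> WW"

lemma opposite_model: "additive_model_category (opposite C) (\<lambda>x y. G y x) Fib Cofib Weq"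
  using additive_opposite model_structure_opposite by (rule additive_model_category.intro)

lemma cofibrant_opposite [simp]: "cofibrant_objects (opposite C) S = fibrant_objects C S"
  and fibrant_opposite [simp]: "fibrant_objects (opposite C) S = cofibrant_objects C S"
  by (auto simp: cofibrant_objects_def fibrant_objects_def)

text \<open>\<open>z \<rightarrow> x \<rightarrow> z\<close> is an identity, hence a weak
  equivalence. This makes \<open>WW\<close>, which is defined by maps out of zero objects, invariant
  under dualizing.\<close>

lemma weq_zero_maps_iff:
  assumes z: "zero_object C z" and f: "f \<in> Hom C z x" and g: "g \<in> Hom C x z"
  shows "f \<in> Weq \<longleftrightarrow> g \<in> Weq"
proof -
  have zo: "z \<in> Obj C" using f hom_obj by blast
  have "g \<cdot> f = Ident C z"
    using zero_object_unique(1)[OF z zo comp_hom[OF f g] ident_hom[OF zo]] .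
  then have "g \<cdot> f \<in> Weq"
    using ident_trivial_cofib[OF zo] by simp
  then show ?thesis
    using two_of_three(2,3)[OF f g] by blast
qed

lemma trivial_opposite [simp]: "trivial_objects (opposite C) Weq = WW"
proof -
  have "(\<exists>f\<in>Hom C x z. f \<in> Weq) \<longleftrightarrow> (\<exists>f\<in>Hom C z x. f \<in> Weq)"
    if "x \<in> Obj C" "zero_object C z" for x z
    using zero_object_unique(3,4)[OF that(2,1)] weq_zero_maps_iff[OF that(2)] by blast
  then show ?thesis
    unfolding trivial_objects_def by (simp, blast)
qed

lemma cofibrant_iff: "x \<in> CC \<longleftrightarrow> projective C (Fib \<inter> Weq) x"
proof
  assume "x \<in> CC"
  then obtain z f where "zero_object C z" "f \<in> Hom C z x" "f \<in> Cofib"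
    unfolding cofibrant_objects_def by blast
  then show "projective C (Fib \<inter> Weq) x"
    using projective_iff_lifts[of z f x "Fib \<inter> Weq"] lifting(1) classes by blast
next
  assume P: "projective C (Fib \<inter> Weq) x"
  then have x: "x \<in> Obj C" unfolding projective_def by blast
  obtain z where z: "zero_object C z" using ex_zero_object by blast
  obtain f where f: "f \<in> Hom C z x" using zero_object_unique(3)[OF z x] by blast
  have "f \<in> Cofib"
    using cofibI[OF f] projective_iff_lifts[OF z f, of "Fib \<inter> Weq"] P classes by blast
  then show "x \<in> CC"
    using x z f unfolding cofibrant_objects_def by blast
qed

lemma trivial_cofibrant_iff: "x \<in> CC \<inter> WW \<longleftrightarrow> projective C Fib x"
proof
  assume x: "x \<in> CC \<inter> WW"
  then obtain z f where z: "zero_object C z" "f \<in> Hom C z x" "f \<in> Weq"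
    unfolding trivial_objects_def by blast
  \<comment> \<open>The zero object witnessing cofibrancy of \<open>x\<close> may differ from
    \<open>z\<close>. Passing through projectivity shows that this very \<open>f\<close>, already
    known to be a weak equivalence, is a cofibration.\<close>
  have "f \<in> Cofib"
    using x cofibrant_iff cofibI[OF z(2)] projective_iff_lifts[OF z(1,2), of "Fib \<inter> Weq"] classes by blast
  then show "projective C Fib x"
    using projective_iff_lifts[OF z(1,2) classes(2)] lifting(2) z(3) by blast
next
  assume P: "projective C Fib x"
  then have x: "x \<in> Obj C" unfolding projective_def by blast
  obtain z where z: "zero_object C z" using ex_zero_object by blast
  obtain f where f: "f \<in> Hom C z x" using zero_object_unique(3)[OF z x] by blast
  have "f \<in> Cofib \<inter> Weq"
    using trivial_cofibI[OF f] projective_iff_lifts[OF z f classes(2)] P by blast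
  then show "x \<in> CC \<inter> WW"
    using x z f unfolding cofibrant_objects_def trivial_objects_def by blast
qed

lemma fibrant_iff: "x \<in> FF \<longleftrightarrow> projective (opposite C) (Cofib \<inter> Weq) x"
  using additive_model_category.cofibrant_iff[OF opposite_model] by simp

lemma trivial_fibrant_iff: "x \<in> FF \<inter> WW \<longleftrightarrow> projective (opposite C) Cofib x"
  using additive_model_category.trivial_cofibrant_iff[OF opposite_model] by simp

lemma cofibrant_lift:
  assumes "x \<in> CC" "p \<in> Fib \<inter> Weq" "p \<in> Hom C e b" "v \<in> Hom C x b"
  obtains h where "h \<in> Hom C x e" "p \<cdot> h = v"
  using projectiveD assms cofibrant_iff by metis

lemma fibrant_extend:
  assumes "x \<in> FF" "i \<in> Cofib \<inter> Weq" "i \<in> Hom C a b" "u \<in> Hom C a x"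
  obtains h where "h \<in> Hom C b x" "h \<cdot> i = u"
  using projectiveD[of "opposite C" "Cofib \<inter> Weq" x i b a u] assms fibrant_iff by auto

lemma trivial_fibrant_extend:
  assumes "x \<in> FF \<inter> WW" "i \<in> Cofib" "i \<in> Hom C a b" "u \<in> Hom C a x"
  obtains h where "h \<in> Hom C b x" "h \<cdot> i = u"
  using projectiveD[of "opposite C" Cofib x i b a u] assms trivial_fibrant_iff by auto

lemma cofibrant_biproduct:
  assumes "x \<in> CC" "y \<in> CC" "biproduct C G x y b i j p q"
  shows "b \<in> CC"
  using projective_biproduct[OF _ _ assms(3)] assms(1,2) by (simp only: cofibrant_iff)

lemma trivial_cofibrant_biproduct:
  assumes "x \<in> CC \<inter> WW" "y \<in> CC \<inter> WW" "biproduct C G x y b i j p q"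
  shows "b \<in> CC \<inter> WW"
  using projective_biproduct[OF _ _ assms(3)] assms(1,2) by (simp only: trivial_cofibrant_iff)

lemma fibrant_biproduct:
  assumes "x \<in> FF" "y \<in> FF" "biproduct C G x y b i j p q"
  shows "b \<in> FF"
  using additive_model_category.cofibrant_biproduct[OF opposite_model _ _ biproduct_opposite[OF assms(3)]]
    assms(1,2) by simp

text \<open>Composition of cofibrations is not an axiom. Instead \<open>v\<close> is lifted in two
  steps: on \<open>x\<close> by cofibrancy, then from \<open>x\<close> to \<open>y\<close> by the
  lifting property of \<open>i\<close>.\<close>

lemma cofibrant_cofib:
  assumes x: "x \<in> CC" and i: "i \<in> Hom C x y" "i \<in> Cofib"
  shows "y \<in> CC"
  unfolding cofibrant_iff projective_def
proof (intro conjI allI impI)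
  show "y \<in> Obj C" using i hom_obj by blast
  fix p e b v assume p: "p \<in> Fib \<inter> Weq" "p \<in> Hom C e b" and v: "v \<in> Hom C y b"
  obtain h where "h \<in> Hom C x e" "p \<cdot> h = v \<cdot> i"
    using cofibrant_lift[OF x p comp_hom[OF i(1) v]] .
  then show "\<exists>h\<in>Hom C y e. p \<cdot> h = v"
    using lifting(1)[OF i(2) p(1)] i p v unfolding lifts_against_def by meson
qed

lemma fibrant_fib:
  assumes "y \<in> FF" "p \<in> Hom C x y" "p \<in> Fib"
  shows "x \<in> FF"
  using additive_model_category.cofibrant_cofib[OF opposite_model] assms by simp

text \<open>\<open>t\<close> acts as a cone on \<open>x\<close>: cofibrant because \<open>j\<close>
  is a cofibration out of a cofibrant object, fibrant and trivial because
  \<open>t \<rightarrow> 0\<close> is a trivial fibration.\<close>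

lemma cofib_to_trivial:
  assumes x: "x \<in> CC"
  obtains t j where "t \<in> T" "j \<in> Hom C x t" "j \<in> Cofib"
proof -
  obtain z where z: "zero_object C z" using ex_zero_object by blast
  have xo: "x \<in> Obj C" using x unfolding cofibrant_objects_def by blast
  obtain f where f: "f \<in> Hom C x z" using zero_object_unique(4)[OF z xo] by blast
  obtain t j p where t: "j \<in> Hom C x t" "p \<in> Hom C t z" "j \<in> Cofib" "p \<in> Fib \<inter> Weq"
    using factorization(1)[OF f] by blast
  then have to: "t \<in> Obj C" using hom_obj by blast
  obtain g where g: "g \<in> Hom C z t" using zero_object_unique(3)[OF z to] by blast
  have "t \<in> T"
    using to z t cofibrant_cofib[OF x t(1,3)] g weq_zero_maps_iff[OF z g t(2)]
    unfolding fibrant_objects_def trivial_objects_def by blast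
  then show thesis using that t by blast
qed

text \<open>The shape \<open>f = h k + g\<close> is that of membership in the coset of
  \<open>g\<close>. The object \<open>e\<close> is arbitrary, so that lifts into a replacement
  \<open>q y\<close>, which may fail to be fibrant, can be compared.\<close>

lemma trivial_fib_homotopy:
  assumes x: "x \<in> CC" and p: "p \<in> Fib \<inter> Weq" "p \<in> Hom C e b"
    and f: "f \<in> Hom C x e" and g: "g \<in> Hom C x e" and eq: "p \<cdot> f = p \<cdot> g"
  obtains t k h where "t \<in> T" "k \<in> Hom C x t" "h \<in> Hom C t e" "f = (h \<cdot> k) \<otimes>\<^bsub>G x e\<^esub> g"
proof -
  have o: "x \<in> Obj C" "e \<in> Obj C" "b \<in> Obj C"
    using f p hom_obj by auto
  interpret xe: comm_group "G x e" using hom_comm_group o by blast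
  interpret xb: comm_group "G x b" using hom_comm_group o by blast
  define d where "d = f \<otimes>\<^bsub>G x e\<^esub> inv\<^bsub>G x e\<^esub> g"
  have ig: "inv\<^bsub>G x e\<^esub> g \<in> Hom C x e"
    using g carrier_hom o by (metis xe.inv_closed)
  have d: "d \<in> Hom C x e"
    unfolding d_def using add_hom f ig by blast
  have "p \<cdot> d = \<one>\<^bsub>G x b\<^esub>"
    unfolding d_def using comp_add[OF f ig p(2)] comp_inv[OF g p(2)] eq comp_hom[OF g p(2)] carrier_hom o
    by simp
  obtain t j where t: "t \<in> T" "j \<in> Hom C x t" "j \<in> Cofib"
    using cofib_to_trivial[OF x] .
  have to: "t \<in> Obj C" using t hom_obj by blast
  \<comment> \<open>The zero map on the cone \<open>t\<close> closes the square with top edge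
    \<open>d\<close>; a diagonal then factors \<open>d\<close> through \<open>t\<close>.\<close>
  have "p \<cdot> d = \<one>\<^bsub>G t b\<^esub> \<cdot> j"
    using zero_comp[OF t(2) o(3)] \<open>p \<cdot> d = \<one>\<^bsub>G x b\<^esub>\<close> by simp
  then obtain h where h: "h \<in> Hom C t e" "h \<cdot> j = d"
    using lifting(1)[OF t(3) p(1)] t(2) p(2) d zero_hom[OF to o(3)] unfolding lifts_against_def by meson
  have "f = d \<otimes>\<^bsub>G x e\<^esub> g"
    unfolding d_def using f g ig xe.m_assoc[of f "inv\<^bsub>G x e\<^esub> g" g] carrier_hom[OF o(1,2)] by simp
  then show thesis
    using that[OF t(1,2) h(1)] h(2) by simp
qed

lemma trivial_cofib_homotopy:
  assumes y: "y \<in> FF" and i: "i \<in> Cofib \<inter> Weq" "i \<in> Hom C a b"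
    and f: "f \<in> Hom C b y" and g: "g \<in> Hom C b y" and eq: "f \<cdot> i = g \<cdot> i"
  obtains t k h where "t \<in> T" "k \<in> Hom C b t" "h \<in> Hom C t y" "f = (h \<cdot> k) \<otimes>\<^bsub>G b y\<^esub> g"
  \<comment> \<open>Reversing arrows makes the two factors through \<open>t\<close> trade
    places.\<close>
  by (rule additive_model_category.trivial_fib_homotopy[OF opposite_model, of y i b a f g])
    (use assms that in auto)

end

section \<open>Weak equivalences between bifibrant objects\<close>

context additive_model_category
begin

lemma bifibrant_obj: "x \<in> B \<Longrightarrow> x \<in> Obj C"
  unfolding cofibrant_objects_def by blast

lemma zero_object_trivial:
  assumes z: "zero_object C z"
  shows "z \<in> T"
proof -
  have "z \<in> Obj C" using z unfolding zero_object_def by blast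
  then show ?thesis
    using z ident_hom ident_trivial_cofib ident_fib
    unfolding cofibrant_objects_def fibrant_objects_def trivial_objects_def by blast
qed

lemma additive_bifibrant: "additive_category (full_subcat C B) G"
proof (rule additive_full_subcat)
  show "B \<subseteq> Obj C" using bifibrant_obj by blast
  show "\<exists>z\<in>B. zero_object C z"
    using ex_zero_object zero_object_trivial by blast
  fix x y assume xy: "x \<in> B" "y \<in> B"
  then obtain b i j p q where b: "biproduct C G x y b i j p q"
    using ex_biproduct bifibrant_obj by blast
  then have "b \<in> B"
    using xy cofibrant_biproduct[OF _ _ b] fibrant_biproduct[OF _ _ b] by blast
  with b show "\<exists>b\<in>B. \<exists>i j p q. biproduct C G x y b i j p q" by blast
qed

text \<open>From here on \<open>bifibrant.Q\<close> is the quotient of the theorem. Its ambient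
  category is the full subcategory on \<open>B\<close>, while sums are still taken in the groups
  \<open>G\<close> of \<open>C\<close>.\<close>

sublocale bifibrant: additive_subcategory "full_subcat C B" G T
proof (rule additive_subcategory.intro[OF additive_bifibrant additive_subcategory_axioms.intro])
  show "T \<subseteq> Obj (full_subcat C B)" by auto
  show "T \<noteq> {}"
    using ex_zero_object zero_object_trivial by blast
  fix x y assume xy: "x \<in> T" "y \<in> T"
  then obtain b i j p q where b: "biproduct C G x y b i j p q"
    using ex_biproduct bifibrant_obj by blast
  \<comment> \<open>\<open>T\<close> is the intersection of \<open>CC \<inter> WW\<close> with
    \<open>FF\<close>. Each is closed under biproducts, the first as the class of projectives for
    \<open>Fib\<close>.\<close>
  then have "b \<in> T"
    using xy trivial_cofibrant_biproduct[OF _ _ b] fibrant_biproduct[OF _ _ b] by blast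
  moreover have "biproduct (full_subcat C B) G x y b i j p q"
    using b xy \<open>b \<in> T\<close> unfolding biproduct_def by simp
  ultimately show "\<exists>b\<in>T. \<exists>i j p q. biproduct (full_subcat C B) G x y b i j p q" by blast
qed

abbreviation "cls \<equiv> bifibrant.coset"

lemma cls_eq_of_homotopy:
  assumes xy: "x \<in> B" "y \<in> B" and t: "t \<in> T" "k \<in> Hom C x t" "h \<in> Hom C t y" and g: "g \<in> Hom C x y"
    and f: "f = (h \<cdot> k) \<otimes>\<^bsub>G x y\<^esub> g"
  shows "cls x y f = cls x y g"
proof -
  have "h \<cdot> k \<in> bifibrant.N x y"
    using bifibrant.factoring_throughI[of t k x h y] xy t by simp
  then have "f \<in> cls x y g"
    unfolding bifibrant.mem_coset_iff using f by blast
  then show ?thesis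
    using bifibrant.coset_eqI xy g by simp
qed

text \<open>Cofibrancy of \<open>y\<close> yields a section \<open>s\<close>. Since
  \<open>s p\<close> and the identity agree after composing with \<open>p\<close>, they differ by a
  map through \<open>T\<close>, so \<open>s\<close> becomes a two-sided inverse.\<close>

lemma trivial_fib_inverse:
  assumes xy: "x \<in> B" "y \<in> B" and p: "p \<in> Hom C x y" "p \<in> Fib \<inter> Weq"
  shows "isomorphism bifibrant.Q x y (cls x y p)"
proof -
  have o: "x \<in> Obj C" "y \<in> Obj C"
    using xy bifibrant_obj by auto
  obtain s where s: "s \<in> Hom C y x" "p \<cdot> s = Ident C y"
    using cofibrant_lift[OF _ p(2,1) ident_hom[OF o(2)]] xy by blast
  have sp: "s \<cdot> p \<in> Hom C x x" using comp_hom p s by blast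
  have "p \<cdot> (s \<cdot> p) = p \<cdot> Ident C x"
    using comp_assoc[OF p(1) s(1) p(1)] s(2) comp_ident_left[OF p(1)] comp_ident_right[OF p(1)] by simp
  then obtain t k h where "t \<in> T" "k \<in> Hom C x t" "h \<in> Hom C t x" "s \<cdot> p = (h \<cdot> k) \<otimes>\<^bsub>G x x\<^esub> Ident C x"
    using trivial_fib_homotopy[OF _ p(2,1) sp ident_hom[OF o(1)]] xy by blast
  then have "cls x x (s \<cdot> p) = cls x x (Ident C x)"
    using cls_eq_of_homotopy xy ident_hom[OF o(1)] by blast
  then have "inverse_morphisms bifibrant.Q x y (cls x y p) (cls y x s)"
    using xy p s bifibrant.coset_hom[of p x y] bifibrant.coset_hom[of s y x]
      bifibrant.comp_quotient[of p x y s x] bifibrant.comp_quotient[of s y x p y]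
    unfolding inverse_morphisms_def by (simp add: bifibrant.Ident_quotient)
  then show ?thesis
    unfolding isomorphism_def by blast
qed

text \<open>Mirror image: fibrancy of \<open>x\<close> yields a retraction \<open>r\<close>, and
  \<open>i r\<close> agrees with the identity after precomposing with \<open>i\<close>.\<close>

lemma trivial_cofib_inverse:
  assumes xy: "x \<in> B" "y \<in> B" and i: "i \<in> Hom C x y" "i \<in> Cofib \<inter> Weq"
  shows "isomorphism bifibrant.Q x y (cls x y i)"
proof -
  have o: "x \<in> Obj C" "y \<in> Obj C"
    using xy bifibrant_obj by auto
  obtain r where r: "r \<in> Hom C y x" "r \<cdot> i = Ident C x"
    using fibrant_extend[OF _ i(2,1) ident_hom[OF o(1)]] xy by blast
  have ir: "i \<cdot> r \<in> Hom C y y" using comp_hom i r by blast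
  have "(i \<cdot> r) \<cdot> i = Ident C y \<cdot> i"
    using comp_assoc[OF i(1) r(1) i(1)] r(2) comp_ident_left[OF i(1)] comp_ident_right[OF i(1)] by simp
  then obtain t k h where "t \<in> T" "k \<in> Hom C y t" "h \<in> Hom C t y" "i \<cdot> r = (h \<cdot> k) \<otimes>\<^bsub>G y y\<^esub> Ident C y"
    using trivial_cofib_homotopy[OF _ i(2,1) ir ident_hom[OF o(2)]] xy by blast
  then have "cls y y (i \<cdot> r) = cls y y (Ident C y)"
    using cls_eq_of_homotopy xy ident_hom[OF o(2)] by blast
  then have "inverse_morphisms bifibrant.Q x y (cls x y i) (cls y x r)"
    using xy i r bifibrant.coset_hom[of i x y] bifibrant.coset_hom[of r y x]
      bifibrant.comp_quotient[of i x y r x] bifibrant.comp_quotient[of r y x i y]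
    unfolding inverse_morphisms_def by (simp add: bifibrant.Ident_quotient)
  then show ?thesis
    unfolding isomorphism_def by blast
qed

text \<open>Factor \<open>w\<close> as a trivial cofibration and a fibration, the latter trivial by
  two-out-of-three. The middle object inherits cofibrancy from \<open>x\<close> and fibrancy from
  \<open>y\<close>, so both factors become invertible.\<close>

lemma weq_inverse:
  assumes xy: "x \<in> B" "y \<in> B" and w: "w \<in> Hom C x y" "w \<in> Weq"
  shows "isomorphism bifibrant.Q x y (cls x y w)"
proof -
  interpret Q: category bifibrant.Q by (rule bifibrant.category_quotient)
  obtain z i p where z: "i \<in> Hom C x z" "p \<in> Hom C z y" "p \<cdot> i = w" "i \<in> Cofib \<inter> Weq" "p \<in> Fib"
    using factorization(2)[OF w(1)] by blast
  then have p: "p \<in> Fib \<inter> Weq"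
    using two_of_three(2)[OF z(1,2)] w by blast
  have zB: "z \<in> B"
    using cofibrant_cofib[OF _ z(1)] fibrant_fib[OF _ z(2)] xy z by blast
  obtain i' p' where inv: "inverse_morphisms bifibrant.Q x z (cls x z i) i'"
      "inverse_morphisms bifibrant.Q z y (cls z y p) p'"
    using trivial_cofib_inverse[OF xy(1) zB z(1,4)] trivial_fib_inverse[OF zB xy(2) z(2) p]
    unfolding isomorphism_def by blast
  have "cls z y p \<cdot>\<^bsub>bifibrant.Q\<^esub> cls x z i = cls x y w"
    using bifibrant.comp_quotient[of i x z p y] xy zB z by simp
  then show ?thesis
    using Q.inverse_morphisms_comp[OF inv] unfolding isomorphism_def by auto
qed

section \<open>Homotopic maps agree in the localization\<close>

abbreviation "loc \<equiv> localize C Weq"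
abbreviation "L \<equiv> Ho C Weq"

text \<open>Both \<open>(1, k)\<close> and \<open>(1, 0)\<close> are sections of the trivial fibration \<open>x \<oplus> t \<rightarrow> x\<close>, so they have
  the same image in the localization; compose with \<open>(g, h) : x \<oplus> t \<rightarrow> y\<close>.\<close>

lemma localize_homotopic:
  assumes t: "t \<in> FF \<inter> WW" and k: "k \<in> Hom C x t" and h: "h \<in> Hom C t y" and g: "g \<in> Hom C x y"
  shows "loc ((h \<cdot> k) \<otimes>\<^bsub>G x y\<^esub> g) = loc g"
proof -
  interpret L: category L by (rule category_localization) (rule category_axioms)
  interpret loc: cat_functor C L id loc by (rule functor_localize) (rule category_axioms)
  have o: "x \<in> Obj C" "t \<in> Obj C" "y \<in> Obj C"
    using k h hom_obj by auto
  interpret xy: comm_group "G x y" using hom_comm_group o by blast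
  obtain b i j p q where b: "biproduct C G x t b i j p q"
    using ex_biproduct o by blast
  then have m: "i \<in> Hom C x b" "j \<in> Hom C t b" "p \<in> Hom C b x" "q \<in> Hom C b t"
    unfolding biproduct_def by auto
  have "p \<in> Fib \<inter> Weq"
  proof -
    \<comment> \<open>\<open>p\<close> is the identity on one summand and
      \<open>t \<rightarrow> 0\<close> on the other. So the \<open>x\<close>-component of a diagonal
      is \<open>v\<close>, and the \<open>t\<close>-component extends \<open>q \<cdot> u\<close>
      along \<open>c\<close>, as \<open>t\<close> is injective for cofibrations.\<close>
    have "lifts_against C c p" if c: "c \<in> Cofib" for c
      unfolding lifts_against_def
    proof (intro allI impI)
      fix a a' d e u v
      assume as: "c \<in> Hom C a a'" "p \<in> Hom C d e" "u \<in> Hom C a d" "v \<in> Hom C a' e" "p \<cdot> u = v \<cdot> c"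
      then have de: "d = b" "e = x"
        using hom_disjoint m by auto
      then have u: "u \<in> Hom C a b" and v: "v \<in> Hom C a' x"
        using as by auto
      obtain w where w: "w \<in> Hom C a' t" "w \<cdot> c = q \<cdot> u"
        using trivial_fibrant_extend[OF t c as(1) comp_hom[OF u m(4)]] .
      let ?l = "(i \<cdot> v) \<otimes>\<^bsub>G a' b\<^esub> (j \<cdot> w)"
      have "?l \<cdot> c = (i \<cdot> (p \<cdot> u)) \<otimes>\<^bsub>G a b\<^esub> (j \<cdot> (q \<cdot> u))"
        using add_comp[OF as(1) comp_hom[OF v m(1)] comp_hom[OF w(1) m(2)]]
          comp_assoc[OF as(1) v m(1)] comp_assoc[OF as(1) w(1) m(2)] w(2) as(5) by simp
      then show "\<exists>h\<in>Hom C a' d. h \<cdot> c = u \<and> p \<cdot> h = v"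
        using biproduct_components[OF b u] biproduct_pair(1)[OF b v w(1)] de
          add_hom[OF comp_hom[OF v m(1)] comp_hom[OF w(1) m(2)]] by auto
    qed
    \<comment> \<open>\<open>trivial_cofibI\<close> read in the opposite category: a map with the
      right lifting property against all cofibrations is a trivial fibration.\<close>
    then show ?thesis
      using model_structure.trivial_cofibI[OF model_structure_opposite, of p x b] m(3)
        lifts_against_opposite[of C _ p] by simp
  qed
  then have inv: "inverse_morphisms L b x (loc p) (zigzag_class C Weq x b [Bwd p])"
    using localize_inverts[OF category_axioms] m(3) by blast
  note idx = ident_hom[OF o(1)]
  let ?s = "\<lambda>k. (i \<cdot> Ident C x) \<otimes>\<^bsub>G x b\<^esub> (j \<cdot> k)"
  let ?e = "(g \<cdot> p) \<otimes>\<^bsub>G b y\<^esub> (h \<cdot> q)"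
  have e: "?e \<in> Hom C b y"
    using add_hom comp_hom m g h by blast
  have s: "?s k \<in> Hom C x b" if "k \<in> Hom C x t" for k
    using add_hom comp_hom[OF idx m(1)] comp_hom[OF that m(2)] by blast
  have sec: "loc p \<cdot>\<^bsub>L\<^esub> loc (?s k) = loc (Ident C x)" "loc (?s k) \<in> Hom L x b"
    if "k \<in> Hom C x t" for k
    using loc.map_comp[OF s[OF that] m(3)] biproduct_pair(1)[OF b idx that] loc.hom_map[OF s[OF that]]
    by simp_all
  note k0 = zero_hom[OF o(1,2)]
  have "loc (?s k) = loc (?s \<one>\<^bsub>G x t\<^esub>)"
    by (rule L.iso_cancel_left[OF inv sec(2)[OF k] sec(2)[OF k0]]) (simp only: sec(1)[OF k] sec(1)[OF k0])
  then have "loc (?e \<cdot> ?s k) = loc (?e \<cdot> ?s \<one>\<^bsub>G x t\<^esub>)"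
    using loc.map_comp[OF s e] k zero_hom[OF o(1,2)] by simp
  moreover have "?e \<cdot> ?s k = (h \<cdot> k) \<otimes>\<^bsub>G x y\<^esub> g"
    using biproduct_matrix[OF b idx k g h] comp_ident_right[OF g] comp_hom[OF k h] g
      xy.m_comm carrier_hom[OF o(1,3)] by simp
  moreover have "?e \<cdot> ?s \<one>\<^bsub>G x t\<^esub> = g"
    using biproduct_matrix[OF b idx zero_hom[OF o(1,2)] g h] comp_ident_right[OF g]
      comp_zero[OF h o(1)] g xy.r_one carrier_hom[OF o(1,3)] by simp
  ultimately show ?thesis by simp
qed

section \<open>Bifibrant replacement and the equivalence\<close>

lemma ex_bifibrant_replacement:
  assumes x: "x \<in> Obj C"
  shows "\<exists>q r p i. q \<in> CC \<and> r \<in> B \<and> p \<in> Hom C q x \<and> p \<in> Fib \<inter> Weq \<and> i \<in> Hom C q r \<and>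
    i \<in> Cofib \<inter> Weq \<and> (x \<in> B \<longrightarrow> q = x \<and> r = x \<and> p = Ident C x \<and> i = Ident C x)"
proof (cases "x \<in> B")
  case True
  then show ?thesis
    using ident_hom[OF x] ident_trivial_cofib[OF x] ident_fib[OF x] by blast
next
  case False
  obtain z where z: "zero_object C z" using ex_zero_object by blast
  obtain f where "f \<in> Hom C z x" using zero_object_unique(3)[OF z x] by blast
  then obtain q c p where q: "c \<in> Hom C z q" "c \<in> Cofib" "p \<in> Hom C q x" "p \<in> Fib \<inter> Weq"
    using factorization(1) by blast
  then have qo: "q \<in> Obj C" and qC: "q \<in> CC"
    using hom_obj z unfolding cofibrant_objects_def by blast+
  obtain g where "g \<in> Hom C q z" using zero_object_unique(4)[OF z qo] by blast
  then obtain r i d where r: "i \<in> Hom C q r" "i \<in> Cofib \<inter> Weq" "d \<in> Hom C r z" "d \<in> Fib"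
    using factorization(2) by blast
  then have "r \<in> FF" "r \<in> CC"
    using hom_obj z cofibrant_cofib[OF qC r(1)] unfolding fibrant_objects_def by blast+
  then show ?thesis
    using False q qC r by blast
qed

end

text \<open>The replacements are fixed as functions so that \<open>r\<close> acts on objects. The
  equalities on \<open>B\<close> make \<open>r\<close> a strict left inverse of the inclusion, which
  \<open>additive_along_equivalence\<close> demands.\<close>

locale bifibrant_replacement = additive_model_category C G Cofib Fib Weq
  for C :: "('o, 'm) cat" (structure) and G :: "'o \<Rightarrow> 'o \<Rightarrow> 'm monoid" and Cofib Fib Weq :: "'m set" +
  fixes q r :: "'o \<Rightarrow> 'o" and p i :: "'o \<Rightarrow> 'm"
  assumes q: "x \<in> Obj C \<Longrightarrow> q x \<in> CC" and r: "x \<in> Obj C \<Longrightarrow> r x \<in> B"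
    and p: "x \<in> Obj C \<Longrightarrow> p x \<in> Hom C (q x) x" "x \<in> Obj C \<Longrightarrow> p x \<in> Fib \<inter> Weq"
    and i: "x \<in> Obj C \<Longrightarrow> i x \<in> Hom C (q x) (r x)" "x \<in> Obj C \<Longrightarrow> i x \<in> Cofib \<inter> Weq"
    and on_bifibrant: "x \<in> B \<Longrightarrow> q x = x" "x \<in> B \<Longrightarrow> r x = x"
      "x \<in> B \<Longrightarrow> p x = Ident C x" "x \<in> B \<Longrightarrow> i x = Ident C x"
begin

text \<open>A relation, because \<open>f\<close> determines its lift \<open>g\<close> and the
  extension \<open>s\<close> only up to homotopy.\<close>

definition replaces :: "'o \<Rightarrow> 'o \<Rightarrow> 'm \<Rightarrow> 'm \<Rightarrow> 'm \<Rightarrow> bool" where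
  "replaces x y f g s \<longleftrightarrow> g \<in> Hom C (q x) (q y) \<and> s \<in> Hom C (r x) (r y) \<and>
     p y \<cdot> g = f \<cdot> p x \<and> s \<cdot> i x = i y \<cdot> g"

lemma ex_replaces:
  assumes f: "f \<in> Hom C x y"
  shows "\<exists>g s. replaces x y f g s"
proof -
  have o: "x \<in> Obj C" "y \<in> Obj C" using f hom_obj by auto
  obtain g where g: "g \<in> Hom C (q x) (q y)" "p y \<cdot> g = f \<cdot> p x"
    using cofibrant_lift[OF q[OF o(1)] p(2,1)[OF o(2)] comp_hom[OF p(1)[OF o(1)] f]] .
  obtain s where s: "s \<in> Hom C (r x) (r y)" "s \<cdot> i x = i y \<cdot> g"
    using fibrant_extend[OF _ i(2,1)[OF o(1)] comp_hom[OF g(1) i(1)[OF o(2)]]] r[OF o(2)] by blast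
  show ?thesis
    unfolding replaces_def using g s by blast
qed

text \<open>Two homotopies are chained. \<open>g\<close> and \<open>g'\<close> differ by a map
  through some \<open>t\<close> in \<open>T\<close>, but this difference lives on \<open>q x\<close>
  and must be carried over to \<open>r x\<close> before \<open>s\<close> and \<open>s'\<close> can
  be compared.\<close>

lemma replaces_unique:
  assumes o: "x \<in> Obj C" "y \<in> Obj C" and gs: "replaces x y f g s" and gs': "replaces x y f g' s'"
  shows "cls (r x) (r y) s = cls (r x) (r y) s'"
proof -
  have g: "g \<in> Hom C (q x) (q y)" "g' \<in> Hom C (q x) (q y)" "p y \<cdot> g = p y \<cdot> g'"
    and s: "s \<in> Hom C (r x) (r y)" "s' \<in> Hom C (r x) (r y)" "s \<cdot> i x = i y \<cdot> g" "s' \<cdot> i x = i y \<cdot> g'"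
    using gs gs' unfolding replaces_def by auto
  obtain t k h where t: "t \<in> T" and k: "k \<in> Hom C (q x) t" and h: "h \<in> Hom C t (q y)"
    and geq: "g = (h \<cdot> k) \<otimes>\<^bsub>G (q x) (q y)\<^esub> g'"
    using trivial_fib_homotopy[OF q[OF o(1)] p(2,1)[OF o(2)] g] .
  \<comment> \<open>\<open>t\<close> is fibrant, so the leg \<open>k\<close> extends along the
    trivial cofibration \<open>i x\<close>.\<close>
  obtain k' where k': "k' \<in> Hom C (r x) t" "k' \<cdot> i x = k"
    using fibrant_extend[OF _ i(2,1)[OF o(1)] k] t by blast
  note ix = i(1)[OF o(1)] and iy = i(1)[OF o(2)]
  let ?h = "i y \<cdot> h"
  \<comment> \<open>\<open>s'\<close> corrected by the carried-over homotopy. It agrees with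
    \<open>s\<close> after precomposing with \<open>i x\<close>, hence differs from \<open>s\<close>
    by a second map through \<open>T\<close>; both corrections vanish in the quotient.\<close>
  let ?u = "(?h \<cdot> k') \<otimes>\<^bsub>G (r x) (r y)\<^esub> s'"
  have h': "?h \<in> Hom C t (r y)" using comp_hom[OF h iy] .
  have u: "?u \<in> Hom C (r x) (r y)"
    using add_hom[OF comp_hom[OF k'(1) h'] s(2)] .
  have "?u \<cdot> i x = (i y \<cdot> (h \<cdot> k)) \<otimes>\<^bsub>G (q x) (r y)\<^esub> (i y \<cdot> g')"
    using add_comp[OF ix comp_hom[OF k'(1) h'] s(2)] comp_assoc[OF ix k'(1) h'] k'(2) s(4)
      comp_assoc[OF k h iy] by simp
  also have "\<dots> = s \<cdot> i x"
    using comp_add[OF comp_hom[OF k h] g(2) iy] geq s(3) by simp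
  finally have "s \<cdot> i x = ?u \<cdot> i x" ..
  then obtain t' l m where "t' \<in> T" "l \<in> Hom C (r x) t'" "m \<in> Hom C t' (r y)"
      "s = (m \<cdot> l) \<otimes>\<^bsub>G (r x) (r y)\<^esub> ?u"
    using trivial_cofib_homotopy[OF _ i(2,1)[OF o(1)] s(1) u] r[OF o(2)] by blast
  then have "cls (r x) (r y) s = cls (r x) (r y) ?u"
    using cls_eq_of_homotopy[OF r[OF o(1)] r[OF o(2)] _ _ _ u] by blast
  also have "\<dots> = cls (r x) (r y) s'"
    using cls_eq_of_homotopy[OF r[OF o(1)] r[OF o(2)] t k'(1) h' s(2)] by blast
  finally show ?thesis .
qed

lemma replaces_ident:
  "x \<in> Obj C \<Longrightarrow> replaces x x (Ident C x) (Ident C (q x)) (Ident C (r x))"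
  using p(1)[of x] i(1)[of x] hom_obj[OF i(1)[of x]] ident_hom comp_ident_left comp_ident_right
  unfolding replaces_def by auto

lemma replaces_comp:
  assumes f: "f \<in> Hom C x y" "f' \<in> Hom C y z" and gs: "replaces x y f g s" and gs': "replaces y z f' g' s'"
  shows "replaces x z (f' \<cdot> f) (g' \<cdot> g) (s' \<cdot> s)"
proof -
  have o: "x \<in> Obj C" "y \<in> Obj C" "z \<in> Obj C" using f hom_obj by auto
  note P = p(1)[OF o(1)] p(1)[OF o(2)] p(1)[OF o(3)] and I = i(1)[OF o(1)] i(1)[OF o(2)] i(1)[OF o(3)]
  have g: "g \<in> Hom C (q x) (q y)" "g' \<in> Hom C (q y) (q z)" "p y \<cdot> g = f \<cdot> p x" "p z \<cdot> g' = f' \<cdot> p y"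
    and s: "s \<in> Hom C (r x) (r y)" "s' \<in> Hom C (r y) (r z)" "s \<cdot> i x = i y \<cdot> g" "s' \<cdot> i y = i z \<cdot> g'"
    using gs gs' unfolding replaces_def by auto
  show ?thesis
    unfolding replaces_def
    using square_comp[OF P g(1,2) f g(3,4)[symmetric]] square_comp[OF I g(1,2) s(1,2) s(3,4)]
      comp_hom[OF g(1,2)] comp_hom[OF s(1,2)] by simp
qed

lemma replacement_functor:
  "\<exists>Km. cat_functor C bifibrant.Q r Km \<and>
     (\<forall>x y f g s. f \<in> Hom C x y \<longrightarrow> replaces x y f g s \<longrightarrow> Km f = cls (r x) (r y) s)"
proof -
  let ?\<Phi> = "\<lambda>x y f U. \<exists>g s. replaces x y f g s \<and> U = cls (r x) (r y) s"
  have "\<exists>Km. cat_functor C bifibrant.Q r Km \<and> (\<forall>x y f U. f \<in> Hom C x y \<longrightarrow> ?\<Phi> x y f U \<longrightarrow> Km f = U)"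
  proof (rule functor_of_relation)
    show "category C" by (rule category_axioms)
    show "category bifibrant.Q" by (rule bifibrant.category_quotient)
    show "r x \<in> Obj bifibrant.Q" if "x \<in> Obj C" for x
      using r[OF that] by simp
    show "\<exists>U. ?\<Phi> x y f U" if "f \<in> Hom C x y" for x y f
      using ex_replaces[OF that] by blast
    show "U \<in> Hom bifibrant.Q (r x) (r y)" if f: "f \<in> Hom C x y" and U: "?\<Phi> x y f U" for x y f U
      using U r hom_obj[OF f] bifibrant.coset_hom unfolding replaces_def by auto
    show "U = V" if f: "f \<in> Hom C x y" and "?\<Phi> x y f U" "?\<Phi> x y f V" for x y f U V
      using that(2,3) replaces_unique hom_obj[OF f] by blast
    show "?\<Phi> x x (Ident C x) (Ident bifibrant.Q (r x))" if "x \<in> Obj C" for x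
      using replaces_ident[OF that] bifibrant.Ident_quotient by auto
    fix x y z f f' U V
    assume f: "f \<in> Hom C x y" "f' \<in> Hom C y z" and "?\<Phi> x y f U" "?\<Phi> y z f' V"
    then obtain g s g' s' where gs: "replaces x y f g s" "U = cls (r x) (r y) s"
      "replaces y z f' g' s'" "V = cls (r y) (r z) s'" by blast
    then have "V \<cdot>\<^bsub>bifibrant.Q\<^esub> U = cls (r x) (r z) (s' \<cdot> s)"
      using bifibrant.comp_quotient[of s "r x" "r y" s' "r z"] r hom_obj[OF f(1)] hom_obj[OF f(2)]
      unfolding replaces_def by simp
    then show "?\<Phi> x z (f' \<cdot> f) (V \<cdot>\<^bsub>bifibrant.Q\<^esub> U)"
      using replaces_comp[OF f gs(1,3)] by blast
  qed
  then show ?thesis by blast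
qed

text \<open>Two-out-of-three around each of the two squares, whose edges \<open>p\<close> and
  \<open>i\<close> are weak equivalences.\<close>

lemma replaces_weq:
  assumes f: "f \<in> Hom C x y" "f \<in> Weq" and gs: "replaces x y f g s"
  shows "s \<in> Weq"
proof -
  have o: "x \<in> Obj C" "y \<in> Obj C" using f hom_obj by auto
  have g: "g \<in> Hom C (q x) (q y)" "p y \<cdot> g = f \<cdot> p x"
    and s: "s \<in> Hom C (r x) (r y)" "s \<cdot> i x = i y \<cdot> g"
    using gs unfolding replaces_def by auto
  have "p y \<cdot> g \<in> Weq"
    using two_of_three(1)[OF p(1)[OF o(1)] f(1)] p(2)[OF o(1)] f(2) g(2) by simp
  then have "g \<in> Weq"
    using two_of_three(3)[OF g(1) p(1)[OF o(2)]] p(2)[OF o(2)] by simp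
  then have "s \<cdot> i x \<in> Weq"
    using two_of_three(1)[OF g(1) i(1)[OF o(2)]] i(2)[OF o(2)] s(2) by simp
  then show ?thesis
    using two_of_three(2)[OF i(1)[OF o(1)] s(1)] i(2)[OF o(1)] by simp
qed

lemma homotopy_functor:
  "\<exists>Km. cat_functor L bifibrant.Q r Km \<and>
     (\<forall>x y f g s. f \<in> Hom C x y \<longrightarrow> replaces x y f g s \<longrightarrow> Km (loc f) = cls (r x) (r y) s)"
proof -
  obtain K0 where K0: "cat_functor C bifibrant.Q r K0"
    and K0_eq: "\<And>x y f g s. f \<in> Hom C x y \<Longrightarrow> replaces x y f g s \<Longrightarrow> K0 f = cls (r x) (r y) s"
    using replacement_functor by blast
  have iso: "isomorphism bifibrant.Q (r x) (r y) (K0 w)" if w: "w \<in> Weq" "w \<in> Hom C x y" for w x y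
  proof -
    obtain g s where gs: "replaces x y w g s" using ex_replaces[OF w(2)] by blast
    then show ?thesis
      using weq_inverse[OF r r _ replaces_weq[OF w(2,1) gs]] hom_obj[OF w(2)] K0_eq[OF w(2) gs]
      unfolding replaces_def by simp
  qed
  obtain Km where Km: "cat_functor L bifibrant.Q r Km" "\<forall>f\<in>Mor C. Km (loc f) = K0 f"
    using localization_lift[OF K0 iso] by metis
  have "Km (loc f) = cls (r x) (r y) s" if "f \<in> Hom C x y" "replaces x y f g s" for x y f g s
    using Km(2) K0_eq[OF that] that(1) hom_obj[OF that(1)] unfolding Mor_def by auto
  then show ?thesis
    using Km(1) by blast
qed

text \<open>The localization functor has to be constant on cosets. Representatives differ by a map
  through an object of \<open>T\<close>, which is fibrant and trivial, as
  \<open>localize_homotopic\<close> asks.\<close>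

lemma inclusion_functor:
  "\<exists>Jm. cat_functor bifibrant.Q L id Jm \<and>
     (\<forall>x y f. x \<in> B \<longrightarrow> y \<in> B \<longrightarrow> f \<in> Hom C x y \<longrightarrow> Jm (cls x y f) = loc f)"
proof -
  interpret loc: cat_functor C L id loc by (rule functor_localize) (rule category_axioms)
  let ?S = "full_subcat C B"
  let ?\<Phi> = "\<lambda>x y U h. \<exists>f\<in>Hom ?S x y. U = cls x y f \<and> h = loc f"
  have "\<exists>Jm. cat_functor bifibrant.Q L id Jm \<and>
      (\<forall>x y U h. U \<in> Hom bifibrant.Q x y \<longrightarrow> ?\<Phi> x y U h \<longrightarrow> Jm U = h)"
  proof (rule functor_of_relation)
    show "category bifibrant.Q" by (rule bifibrant.category_quotient)
    show "category L" by (rule loc.target.category_axioms)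
    show "id x \<in> Obj L" if "x \<in> Obj bifibrant.Q" for x
      using that bifibrant_obj loc.obj_map by simp
    show "\<exists>h. ?\<Phi> x y U h" if "U \<in> Hom bifibrant.Q x y" for x y U
      using that by (auto simp only: bifibrant.Hom_quotient)
    show "h \<in> Hom L (id x) (id y)" if "?\<Phi> x y U h" for x y U h
      using that loc.hom_map by auto
    show "h = h'" if "?\<Phi> x y U h" "?\<Phi> x y U h'" for x y U h h'
    proof -
      obtain f f' where f: "f \<in> Hom ?S x y" "f' \<in> Hom ?S x y" "cls x y f = cls x y f'"
        "h = loc f" "h' = loc f'"
        using \<open>?\<Phi> x y U h\<close> \<open>?\<Phi> x y U h'\<close> by auto
      have "f \<in> cls x y f'"
        using bifibrant.mem_coset_self[OF f(1)] f(3) by simp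
      then obtain t k l where t: "t \<in> T" "k \<in> Hom ?S x t" "l \<in> Hom ?S t y"
        "f = (l \<cdot> k) \<otimes>\<^bsub>G x y\<^esub> f'"
        unfolding bifibrant.mem_coset_iff factoring_through_def by auto
      then show ?thesis
        using localize_homotopic[of t k x l y f'] f by simp
    qed
    show "?\<Phi> x x (Ident bifibrant.Q x) (Ident L (id x))" if "x \<in> Obj bifibrant.Q" for x
      using that bifibrant_obj[of x] ident_hom[of x] loc.map_ident[of x]
      by (intro bexI[of _ "Ident C x"]) (auto simp: bifibrant.Ident_quotient)
    fix x y z U V h h' assume "?\<Phi> x y U h" "?\<Phi> y z V h'"
    then obtain f f' where f: "f \<in> Hom ?S x y" "U = cls x y f" "h = loc f"
      and f': "f' \<in> Hom ?S y z" "V = cls y z f'" "h' = loc f'" by blast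
    then show "?\<Phi> x z (V \<cdot>\<^bsub>bifibrant.Q\<^esub> U) (h' \<cdot>\<^bsub>L\<^esub> h)"
      using bifibrant.comp_quotient[OF f(1) f'(1)] loc.map_comp[of f x y f' z]
        bifibrant.comp_hom[OF f(1) f'(1)]
      by (intro bexI[of _ "f' \<cdot> f"]) auto
  qed
  then obtain Jm where Jm: "cat_functor bifibrant.Q L id Jm"
    and J: "\<And>x y U h. U \<in> Hom bifibrant.Q x y \<Longrightarrow> ?\<Phi> x y U h \<Longrightarrow> Jm U = h" by blast
  have "Jm (cls x y f) = loc f" if "x \<in> B" "y \<in> B" "f \<in> Hom C x y" for x y f
  proof -
    have f: "f \<in> Hom ?S x y" using that by simp
    show ?thesis
      using J[OF bifibrant.coset_hom[OF f]] f by blast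
  qed
  then show ?thesis
    using Jm by blast
qed

theorem homotopy_category_equivalent:
  "\<exists>H. additive_category L H \<and>
     additively_equivalent L H bifibrant.Q (quotient_hom_group (full_subcat C B) G T)"
proof -
  interpret L: category L by (rule category_localization) (rule category_axioms)
  interpret loc: cat_functor C L id loc by (rule functor_localize) (rule category_axioms)
  obtain Km where Km: "cat_functor L bifibrant.Q r Km"
    and K: "\<And>x y f g s. f \<in> Hom C x y \<Longrightarrow> replaces x y f g s \<Longrightarrow> Km (loc f) = cls (r x) (r y) s"
    using homotopy_functor by blast
  obtain Jm where Jm: "cat_functor bifibrant.Q L id Jm"
    and J: "\<And>x y f. x \<in> B \<Longrightarrow> y \<in> B \<Longrightarrow> f \<in> Hom C x y \<Longrightarrow> Jm (cls x y f) = loc f"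
    using inclusion_functor by blast
  interpret Km: cat_functor L bifibrant.Q r Km by fact
  interpret Jm: cat_functor bifibrant.Q L id Jm by fact
  have obj: "Obj L = Obj C" by (simp add: localization_def)
  show ?thesis
  proof (rule additive_along_equivalence[OF Km Jm bifibrant.additive_quotient_additive])
    show "r (id x) = x" if "x \<in> Obj bifibrant.Q" for x
      using that on_bifibrant by simp
    show "Km (Jm U) = U" if U: "U \<in> Hom bifibrant.Q x y" for U x y
    proof -
      obtain f where f: "x \<in> B" "y \<in> B" "f \<in> Hom C x y" "U = cls x y f"
        using U unfolding bifibrant.Hom_quotient by auto
      \<comment> \<open>On bifibrant objects the maps \<open>p\<close> and \<open>i\<close> are
        identities, so \<open>f\<close> serves as its own lift and extension.\<close>
      have "replaces x y f f f"
        unfolding replaces_def using f on_bifibrant comp_ident_left[OF f(3)] comp_ident_right[OF f(3)]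
        by simp
      then show ?thesis
        using K[OF f(3)] J[OF f(1-3)] f on_bifibrant by simp
    qed
    have p_inv: "inverse_morphisms L (q x) x (loc (p x)) (zigzag_class C Weq x (q x) [Bwd (p x)])"
      if "x \<in> Obj C" for x
      using localize_inverts[OF category_axioms _ p(1)[OF that]] p(2)[OF that] by blast
    have i_inv: "inverse_morphisms L (q x) (r x) (loc (i x)) (zigzag_class C Weq (r x) (q x) [Bwd (i x)])"
      if "x \<in> Obj C" for x
      using localize_inverts[OF category_axioms _ i(1)[OF that]] i(2)[OF that] by blast
    \<comment> \<open>The formal inverse of \<open>loc (p x)\<close>, through which the span is read
      as an honest morphism of \<open>L\<close>.\<close>
    define \<rho> where "\<rho> x = zigzag_class C Weq x (q x) [Bwd (p x)]" for x
    have \<rho>: "\<rho> x \<in> Hom L x (q x)" if "x \<in> Obj C" for x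
      using p_inv[OF that] unfolding inverse_morphisms_def \<rho>_def by blast
    have li: "loc (i x) \<in> Hom L (q x) (r x)" "loc (p x) \<in> Hom L (q x) x" if "x \<in> Obj C" for x
      using loc.hom_map i(1)[OF that] p(1)[OF that] by auto
    define \<eta> where "\<eta> x = loc (i x) \<cdot>\<^bsub>L\<^esub> \<rho> x" for x
    have \<eta>: "\<eta> x \<in> Hom L x (r x)" if "x \<in> Obj C" for x
      unfolding \<eta>_def using L.comp_hom[OF \<rho>[OF that] li(1)[OF that]] .
    \<comment> \<open>Of the two squares in \<open>replaces\<close>, the one on \<open>p\<close> is
      inverted and then pasted to the one on \<open>i\<close>.\<close>
    have nat: "Jm (Km (loc f)) \<cdot>\<^bsub>L\<^esub> \<eta> x = \<eta> y \<cdot>\<^bsub>L\<^esub> loc f" if f: "f \<in> Hom C x y" for f x y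
    proof -
      have o: "x \<in> Obj C" "y \<in> Obj C" using f hom_obj by auto
      obtain g s where gs: "replaces x y f g s" using ex_replaces[OF f] by blast
      then have g: "g \<in> Hom C (q x) (q y)" "p y \<cdot> g = f \<cdot> p x"
        and s: "s \<in> Hom C (r x) (r y)" "s \<cdot> i x = i y \<cdot> g"
        unfolding replaces_def by auto
      have lg: "loc g \<in> Hom L (q x) (q y)" "loc s \<in> Hom L (r x) (r y)" "loc f \<in> Hom L x y"
        using loc.hom_map g s f by auto
      have "loc (p y) \<cdot>\<^bsub>L\<^esub> loc g = loc f \<cdot>\<^bsub>L\<^esub> loc (p x)"
        using loc.map_comp[OF g(1) p(1)[OF o(2)]] loc.map_comp[OF p(1)[OF o(1)] f] g(2) by simp
      then have "\<rho> y \<cdot>\<^bsub>L\<^esub> loc f = loc g \<cdot>\<^bsub>L\<^esub> \<rho> x"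
        unfolding \<rho>_def by (rule L.square_inverse[OF lg(1,3) p_inv[OF o(1)] p_inv[OF o(2)]])
      moreover have "loc (i y) \<cdot>\<^bsub>L\<^esub> loc g = loc s \<cdot>\<^bsub>L\<^esub> loc (i x)"
        using loc.map_comp[OF g(1) i(1)[OF o(2)]] loc.map_comp[OF i(1)[OF o(1)] s(1)] s(2) by simp
      ultimately have "\<eta> y \<cdot>\<^bsub>L\<^esub> loc f = loc s \<cdot>\<^bsub>L\<^esub> \<eta> x"
        unfolding \<eta>_def
        by (rule L.square_comp[OF lg(3,1,2) \<rho>[OF o(1)] li(1)[OF o(1)] \<rho>[OF o(2)] li(1)[OF o(2)]])
      moreover have "Jm (Km (loc f)) = loc s"
        using K[OF f gs] J[OF r[OF o(1)] r[OF o(2)] s(1)] by simp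
      ultimately show ?thesis by simp
    qed
    \<comment> \<open>Squares on images of morphisms of \<open>C\<close> suffice, since formal
      inverses inherit them.\<close>
    have nat': "Jm (Km X) \<cdot>\<^bsub>L\<^esub> \<eta> x = \<eta> y \<cdot>\<^bsub>L\<^esub> X" if X: "X \<in> Hom L x y" for X x y
    proof -
      have idL: "cat_functor L L id id"
        by unfold_locales auto
      have JK: "cat_functor L L r (Jm \<circ> Km)"
        using cat_functor_comp[OF Km Jm] by simp
      show ?thesis
        using natural_on_localization[OF category_axioms idL JK _ _ X, of \<eta>] \<eta> nat by simp
    qed
    have "isomorphism L x (r x) (\<eta> x)" if "x \<in> Obj C" for x
      using L.inverse_morphisms_comp[OF inverse_morphisms_sym[OF p_inv[OF that]] i_inv[OF that]]
      unfolding isomorphism_def \<eta>_def \<rho>_def by blast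
    then show "naturally_isomorphic L L id id (id \<circ> r) (Jm \<circ> Km)"
      unfolding naturally_isomorphic_def using nat' obj by (intro exI[of _ \<eta>]) simp
  qed
qed

end

theorem corollaryD:
  fixes A :: "('o, 'm) cat"
    and G :: "'o \<Rightarrow> 'o \<Rightarrow> 'm monoid"
    and Cofib Fib Weq :: "'m set"
    and CC FF WW :: "'o set"
  assumes "weakly_idempotent_complete_category A G"
    and "model_structure A Cofib Fib Weq"
    and "CC = cofibrant_objects A Cofib"
    and "FF = fibrant_objects A Fib"
    and "WW = trivial_objects A Weq"
  shows "\<exists>H. additive_category (Ho A Weq) H \<and>
           additively_equivalent (Ho A Weq) H
             (additive_quotient (full_subcat A (CC \<inter> FF)) G (CC \<inter> FF \<inter> WW))
             (quotient_hom_group (full_subcat A (CC \<inter> FF)) G (CC \<inter> FF \<inter> WW))"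
proof -
  interpret additive_model_category A G Cofib Fib Weq
    using weakly_idempotent_complete_category.axioms(1)[OF assms(1)] assms(2)
    by (rule additive_model_category.intro)
  let ?R = "\<lambda>x q r p i. q \<in> cofibrant_objects A Cofib \<and>
      r \<in> cofibrant_objects A Cofib \<inter> fibrant_objects A Fib \<and>
      p \<in> Hom A q x \<and> p \<in> Fib \<inter> Weq \<and> i \<in> Hom A q r \<and> i \<in> Cofib \<inter> Weq \<and>
      (x \<in> cofibrant_objects A Cofib \<inter> fibrant_objects A Fib \<longrightarrow>
        q = x \<and> r = x \<and> p = Ident A x \<and> i = Ident A x)"
  have "\<forall>x\<in>Obj A. \<exists>q r p i. ?R x q r p i"
    using ex_bifibrant_replacement by blast
  \<comment> \<open>Each witness depends on the earlier ones, so choice is applied once per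
    witness.\<close>
  from bchoice[OF this] obtain q where "\<forall>x\<in>Obj A. \<exists>r p i. ?R x (q x) r p i" by blast
  from bchoice[OF this] obtain r where "\<forall>x\<in>Obj A. \<exists>p i. ?R x (q x) (r x) p i" by blast
  from bchoice[OF this] obtain p where "\<forall>x\<in>Obj A. \<exists>i. ?R x (q x) (r x) (p x) i" by blast
  from bchoice[OF this] obtain i where "\<forall>x\<in>Obj A. ?R x (q x) (r x) (p x) (i x)" by blast
  then have R: "?R x (q x) (r x) (p x) (i x)" if "x \<in> Obj A" for x
    using that by blast
  interpret bifibrant_replacement A G Cofib Fib Weq q r p i
    \<comment> \<open>The locale states its equalities for members of \<open>B\<close> alone;
      \<open>bifibrant_obj\<close> provides the membership in \<open>Obj A\<close> that
      \<open>R\<close> asks for.\<close>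
    by unfold_locales (use R R[OF bifibrant_obj] in simp_all)
  show ?thesis
    using homotopy_category_equivalent unfolding assms(3-5) .
qed

end
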